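(* Let $(A,b)$ be a linear system over $\mathbb{Z}_d$ with associated simplicial complex $\Sigma$. Let $G$ be a group with a central element $J_G$ of order $d$, and let $\chi:G\to U(\mathcal{H})$ be a group homomorphism, where $\mathcal{H}$ is a finite-dimensional complex Hilbert space. Assume that $(A,b)$ admits a solution in $G$, but not in $\mathbb{Z}_d$. Let $f:N(\mathbb{Z}_d,\Sigma)\to N(\mathbb{Z}_d,G)$ be the simplicial set map corresponding to the solution in $G$. Then the simplicial distribution given by the composite $$N(\mathbb{Z}_d,\Sigma)\xrightarrow{f}N(\mathbb{Z}_d,G)\xrightarrow{p_\rho}D(N\mathbb{Z}_d)$$ is contextual for any density operator $\rho$ on $\mathcal{H}$.
   Context: Let $d>1$ and $\omega=e^{2\pi i/d}$. A linear system $(A,b)$ over $\mathbb{Z}_d$: an $r\times c$ matrix $A$ over $\mathbb{Z}_d$ and $b\in\mathbb{Z}_d^r$. $\Sigma$ has vertices $\Sigma_0=\{v_1,\dots,v_c\}$ and is generated by $\sigma_i=\{v_j:A_{ij}\ne0\}$ (simplices: singletons and subsets of the $\sigma_i$; the empty set is allowed as a support). The row $A_i$ is regarded as a function $\Sigma_0\to\mathbb{Z}_d$. Standing assumptions: $\langle A_i\rangle\cong\mathbb{Z}_d$ for each row and $\langle A_i\rangle\neq\langle A_j\rangle$ for distinct rows. A solution in a group $G$ with central element $J_G$ of order $d$ is $T:\Sigma_0\to G$ with $T(v)^d=1$, $\{T(v):v\in\sigma_i\}$ pairwise commuting for each $i$, and $\prod_{v_j\in\sigma_i}T(v_j)^{A_{ij}}=J_G^{b_i}$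 for each $i$. For $G=\mathbb{Z}_d$ one takes $J_G=1$ (the additive generator), so this is an ordinary solution of $Ax=b$. $N(\mathbb{Z}_d,\Sigma)$ is the simplicial subset of the nerve $N(\mathbb{Z}_d^{\Sigma_0})$ with $n$-simplices $(s_1,\dots,s_n)$, $s_i:\Sigma_0\to\mathbb{Z}_d$, $\bigcup_i\mathrm{supp}(s_i)\in\Sigma$. $N(\mathbb{Z}_d,G)\subset NG$ consists of tuples of pairwise commuting elements with $g_i^d=1$. The map $f$ corresponding to a solution $T$ sends $(s_1,\dots,s_n)$ to $(h_1,\dots,h_n)$ with $h_i=\prod_{v\in\mathrm{supp}(s_i)}T(v)^{s_i(v)}$. For a set $U$, $D(U)$ is the set of finitely supported functions $p:U\to\mathbb{R}_{\ge0}$ with $\sum_up(u)=1$; a map $U\to V$ induces $D(U)\to D(V)$ by summing over fibers. For a simplicial set $Y$, $D(Y)$ is the simplicial set with $D(Y)_n=D(Y_n)$ and induced structure maps. A simplicial distribution is a simplicial set map $p:X\to D(Y)$, with $p_\sigma\in D(Y_n)$ denoting its value on $\sigma\in X_n$. For a simplicial set map $s:X\to Y$ the deterministic distribution $\delta^s$ sends $\sigma$ to the delta distribution at $s(\sigma)$. $p$ is non-contextual if there is a finitely supported probability distribution $\lambda$ on the set of simplicial maps $s:X\to Y$ with $p_\sigma(\theta)=\sum_{s:s(\sigma)=\theta}\lambda(s)$ for all $\sigma\in X_n$, $\theta\in Y_n$ and all $n$; otherwise it is contextual. A density operator is a positive operator of trace $1$. The map $p_\rho:N(\mathbb{Z}_d,G)\to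 D(N\mathbb{Z}_d)$ sends $(g_1,\dots,g_n)$ to the distribution $(a_1,\dots,a_n)\mapsto\mathrm{Tr}(\rho\,\Pi(a_1,\dots,a_n))$ on $\mathbb{Z}_d^n$, where $\Pi(a_1,\dots,a_n)$ is the orthogonal projector onto the simultaneous eigenspace of $\chi(g_1),\dots,\chi(g_n)$ with eigenvalues $\omega^{a_1},\dots,\omega^{a_n}$.
   Formalization: It is assumed in addition that χ(J_G) = ω·1; without this the claim fails, e.g. for the trivial homomorphism χ, where every measurement has outcome 0 with certainty and the distribution is non-contextual. *)

theory Defs
  imports "HOL-Analysis.Analysis" "HOL-Algebra.Multiplicative_Group"
    "HOL-Algebra.Product_Groups"
begin

section \<open>Simplicial sets\<close>

text \<open>\<open>face X n i\<close> and \<open>degen X n i\<close> are the operators \<open>d\<^sub>i\<close> and \<open>s\<^sub>i\<close> (\<open>i \<le> n\<close>) on the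
  \<open>n\<close>-simplices; the former is only meaningful for \<open>n \<ge> 1\<close>.\<close>

record 'a sset =
  simplices :: "nat \<Rightarrow> 'a set"
  face :: "nat \<Rightarrow> nat \<Rightarrow> 'a \<Rightarrow> 'a"
  degen :: "nat \<Rightarrow> nat \<Rightarrow> 'a \<Rightarrow> 'a"

definition simplicial_set :: "'a sset \<Rightarrow> bool" where
  "simplicial_set X \<longleftrightarrow>
     (\<forall>n. \<forall>x\<in>simplices X (Suc n). \<forall>i\<le>Suc n. face X (Suc n) i x \<in> simplices X n) \<and>
     (\<forall>n. \<forall>x\<in>simplices X n. \<forall>i\<le>n. degen X n i x \<in> simplices X (Suc n)) \<and>
     (\<forall>n. \<forall>x\<in>simplices X (Suc (Suc n)). \<forall>j\<le>Suc (Suc n). \<forall>i<j.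
        face X (Suc n) i (face X (Suc (Suc n)) j x)
          = face X (Suc n) (j - 1) (face X (Suc (Suc n)) i x)) \<and>
     (\<forall>n. \<forall>x\<in>simplices X n. \<forall>j\<le>n. \<forall>i\<le>j.
        degen X (Suc n) i (degen X n j x) = degen X (Suc n) (Suc j) (degen X n i x)) \<and>
     (\<forall>n. \<forall>x\<in>simplices X n. \<forall>j\<le>n.
        face X (Suc n) j (degen X n j x) = x \<and> face X (Suc n) (Suc j) (degen X n j x) = x) \<and>
     (\<forall>n. \<forall>x\<in>simplices X (Suc n). \<forall>j\<le>Suc n. \<forall>i<j.
        face X (Suc (Suc n)) i (degen X (Suc n) j x) = degen X n (j - 1) (face X (Suc n) i x)) \<and>
     (\<forall>n. \<forall>x\<in>simplices X (Suc n). \<forall>j\<le>n. \<forall>i. Suc j < i \<and> i \<le> Suc (Suc n) \<longrightarrow>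
        face X (Suc (Suc n)) i (degen X (Suc n) j x) = degen X n j (face X (Suc n) (i - 1) x))"

text \<open>Each component of a simplicial map is extensional, so that two functions representing
  the same map are equal.\<close>

definition simplicial_maps :: "'a sset \<Rightarrow> 'b sset \<Rightarrow> (nat \<Rightarrow> 'a \<Rightarrow> 'b) set" where
  "simplicial_maps X Y = {f.
     (\<forall>n. f n \<in> simplices X n \<rightarrow>\<^sub>E simplices Y n) \<and>
     (\<forall>n. \<forall>x\<in>simplices X (Suc n). \<forall>i\<le>Suc n.
        f n (face X (Suc n) i x) = face Y (Suc n) i (f (Suc n) x)) \<and>
     (\<forall>n. \<forall>x\<in>simplices X n. \<forall>i\<le>n. f (Suc n) (degen X n i x) = degen Y n i (f n x))}"

definition comp_map ::
    "'a sset \<Rightarrow> (nat \<Rightarrow> 'b \<Rightarrow> 'c) \<Rightarrow> (nat \<Rightarrow> 'a \<Rightarrow> 'b) \<Rightarrow> nat \<Rightarrow> 'a \<Rightarrow> 'c" where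
  "comp_map X g f = (\<lambda>n. compose (simplices X n) (g n) (f n))"

section \<open>Simplicial distributions\<close>

text \<open>A distribution on \<open>U\<close> is represented by its extension by zero outside \<open>U\<close>.\<close>

definition dist_on :: "'a set \<Rightarrow> ('a \<Rightarrow> real) set" where
  "dist_on U = {p. (\<forall>u. 0 \<le> p u) \<and> {u. p u \<noteq> 0} \<subseteq> U \<and> finite {u. p u \<noteq> 0} \<and>
                   (\<Sum>u\<in>{u. p u \<noteq> 0}. p u) = 1}"

definition push_dist :: "('a \<Rightarrow> 'b) \<Rightarrow> ('a \<Rightarrow> real) \<Rightarrow> 'b \<Rightarrow> real" where
  "push_dist f p v = (\<Sum>u\<in>{u. p u \<noteq> 0 \<and> f u = v}. p u)"

definition dist_sset :: "'a sset \<Rightarrow> ('a \<Rightarrow> real) sset" where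
  "dist_sset Y = \<lparr>simplices = (\<lambda>n. dist_on (simplices Y n)),
                  face = (\<lambda>n i. push_dist (face Y n i)),
                  degen = (\<lambda>n i. push_dist (degen Y n i))\<rparr>"

definition simplicial_distributions ::
    "'a sset \<Rightarrow> 'b sset \<Rightarrow> (nat \<Rightarrow> 'a \<Rightarrow> 'b \<Rightarrow> real) set" where
  "simplicial_distributions X Y = simplicial_maps X (dist_sset Y)"

definition noncontextual ::
    "'a sset \<Rightarrow> 'b sset \<Rightarrow> (nat \<Rightarrow> 'a \<Rightarrow> 'b \<Rightarrow> real) \<Rightarrow> bool" where
  "noncontextual X Y p \<longleftrightarrow> p \<in> simplicial_distributions X Y \<and>
     (\<exists>lam\<in>dist_on (simplicial_maps X Y).
        \<forall>n. \<forall>x\<in>simplices X n. \<forall>y\<in>simplices Y n.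
          p n x y = (\<Sum>s\<in>{s. lam s \<noteq> 0 \<and> s n x = y}. lam s))"

definition contextual ::
    "'a sset \<Rightarrow> 'b sset \<Rightarrow> (nat \<Rightarrow> 'a \<Rightarrow> 'b \<Rightarrow> real) \<Rightarrow> bool" where
  "contextual X Y p \<longleftrightarrow> p \<in> simplicial_distributions X Y \<and> \<not> noncontextual X Y p"

section \<open>Nerves\<close>

text \<open>An \<open>n\<close>-simplex \<open>(g\<^sub>1, \<dots>, g\<^sub>n)\<close> is a list of length \<open>n\<close>; thus \<open>g\<^sub>i\<close> has list index \<open>i - 1\<close>.\<close>

definition nerve_face :: "('a, 'm) monoid_scheme \<Rightarrow> nat \<Rightarrow> nat \<Rightarrow> 'a list \<Rightarrow> 'a list" where
  "nerve_face G n i gs =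
     (if i = 0 then tl gs
      else if i = n then butlast gs
      else take (i - 1) gs @ (gs ! (i - 1) \<otimes>\<^bsub>G\<^esub> gs ! i) # drop (i + 1) gs)"

definition nerve_degen :: "('a, 'm) monoid_scheme \<Rightarrow> nat \<Rightarrow> nat \<Rightarrow> 'a list \<Rightarrow> 'a list" where
  "nerve_degen G n i gs = take i gs @ \<one>\<^bsub>G\<^esub> # drop i gs"

definition nerve :: "('a, 'm) monoid_scheme \<Rightarrow> 'a list sset" where
  "nerve G = \<lparr>simplices = (\<lambda>n. {gs. length gs = n \<and> set gs \<subseteq> carrier G}),
              face = nerve_face G, degen = nerve_degen G\<rparr>"

definition comm_nerve :: "nat \<Rightarrow> ('a, 'm) monoid_scheme \<Rightarrow> 'a list sset" where
  "comm_nerve d G = (nerve G)\<lparr>simplices := (\<lambda>n. {gs \<in> simplices (nerve G) n.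
      (\<forall>g\<in>set gs. \<forall>h\<in>set gs. g \<otimes>\<^bsub>G\<^esub> h = h \<otimes>\<^bsub>G\<^esub> g) \<and>
      (\<forall>g\<in>set gs. g [^]\<^bsub>G\<^esub> d = \<one>\<^bsub>G\<^esub>)})\<rparr>"

section \<open>Linear systems\<close>

text \<open>\<open>\<int>\<^sub>d\<close> is \<^const>\<open>integer_mod_group\<close>, with the residues \<open>0, \<dots>, d - 1\<close> as elements.  The rows
  of \<open>A\<close> are indexed by \<open>{..<r}\<close> and the columns, hence the vertices, by \<open>{..<c}\<close>.\<close>

definition row_support :: "nat \<Rightarrow> (nat \<Rightarrow> nat \<Rightarrow> int) \<Rightarrow> nat \<Rightarrow> nat set" where
  "row_support c A i = {j. j < c \<and> A i j \<noteq> 0}"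

definition support_complex :: "nat \<Rightarrow> nat \<Rightarrow> (nat \<Rightarrow> nat \<Rightarrow> int) \<Rightarrow> nat set set" where
  "support_complex r c A =
     {{}} \<union> {{j} |j. j < c} \<union> (\<Union>i\<in>{..<r}. Pow (row_support c A i))"

definition vertex_functions :: "nat \<Rightarrow> nat \<Rightarrow> (nat \<Rightarrow> int) monoid" where
  "vertex_functions d c = product_group {..<c} (\<lambda>_. integer_mod_group d)"

definition row_function :: "nat \<Rightarrow> (nat \<Rightarrow> nat \<Rightarrow> int) \<Rightarrow> nat \<Rightarrow> nat \<Rightarrow> int" where
  "row_function c A i = (\<lambda>j\<in>{..<c}. A i j)"

definition linear_system ::
    "nat \<Rightarrow> nat \<Rightarrow> nat \<Rightarrow> (nat \<Rightarrow> nat \<Rightarrow> int) \<Rightarrow> (nat \<Rightarrow> int) \<Rightarrow> bool" where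
  "linear_system d r c A b \<longleftrightarrow>
     (\<forall>i<r. \<forall>j<c. A i j \<in> carrier (integer_mod_group d)) \<and>
     (\<forall>i<r. b i \<in> carrier (integer_mod_group d)) \<and>
     (\<forall>i<r. subgroup_generated (vertex_functions d c) {row_function c A i}
              \<cong> integer_mod_group d) \<and>
     (\<forall>i<r. \<forall>k<r. i \<noteq> k \<longrightarrow>
        generate (vertex_functions d c) {row_function c A i}
          \<noteq> generate (vertex_functions d c) {row_function c A k})"

definition supp :: "nat \<Rightarrow> (nat \<Rightarrow> int) \<Rightarrow> nat set" where
  "supp c s = {j. j < c \<and> s j \<noteq> 0}"

definition system_sset ::
    "nat \<Rightarrow> nat \<Rightarrow> nat \<Rightarrow> (nat \<Rightarrow> nat \<Rightarrow> int) \<Rightarrow> (nat \<Rightarrow> int) list sset" where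
  "system_sset d r c A = (nerve (vertex_functions d c))\<lparr>simplices := (\<lambda>n.
      {ss \<in> simplices (nerve (vertex_functions d c)) n.
         (\<Union>s\<in>set ss. supp c s) \<in> support_complex r c A})\<rparr>"

text \<open>The product over a finite set \<open>S\<close> of vertices is taken in increasing order, since \<open>G\<close> need
  not be commutative; it is only used where the factors commute.\<close>

definition vertex_prod :: "('g, 'm) monoid_scheme \<Rightarrow> (nat \<Rightarrow> 'g) \<Rightarrow> nat set \<Rightarrow> 'g" where
  "vertex_prod G F S = foldr (\<lambda>j x. F j \<otimes>\<^bsub>G\<^esub> x) (sorted_list_of_set S) \<one>\<^bsub>G\<^esub>"

definition is_solution ::
    "nat \<Rightarrow> nat \<Rightarrow> nat \<Rightarrow> (nat \<Rightarrow> nat \<Rightarrow> int) \<Rightarrow> (nat \<Rightarrow> int) \<Rightarrow>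
     ('g, 'm) monoid_scheme \<Rightarrow> 'g \<Rightarrow> (nat \<Rightarrow> 'g) \<Rightarrow> bool" where
  "is_solution d r c A b G J T \<longleftrightarrow>
     (\<forall>v<c. T v \<in> carrier G \<and> T v [^]\<^bsub>G\<^esub> d = \<one>\<^bsub>G\<^esub>) \<and>
     (\<forall>i<r. \<forall>u\<in>row_support c A i. \<forall>v\<in>row_support c A i.
        T u \<otimes>\<^bsub>G\<^esub> T v = T v \<otimes>\<^bsub>G\<^esub> T u) \<and>
     (\<forall>i<r. vertex_prod G (\<lambda>j. T j [^]\<^bsub>G\<^esub> A i j) (row_support c A i) = J [^]\<^bsub>G\<^esub> b i)"

definition solution_map ::
    "nat \<Rightarrow> nat \<Rightarrow> nat \<Rightarrow> (nat \<Rightarrow> nat \<Rightarrow> int) \<Rightarrow> ('g, 'm) monoid_scheme \<Rightarrow> (nat \<Rightarrow> 'g) \<Rightarrow>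
     nat \<Rightarrow> (nat \<Rightarrow> int) list \<Rightarrow> 'g list" where
  "solution_map d r c A G T n = (\<lambda>ss\<in>simplices (system_sset d r c A) n.
      map (\<lambda>s. vertex_prod G (\<lambda>j. T j [^]\<^bsub>G\<^esub> s j) (supp c s)) ss)"

section \<open>Quantum measurements\<close>

text \<open>The Hilbert space is \<open>complex ^ 'n\<close>, and operators on it are matrices.  A representation
  \<open>chi\<close> of \<open>G\<close> is meant to send the distinguished central element \<open>J\<close> to \<open>omega d\<close> times the
  identity; this is a separate hypothesis.  Without it the outcomes of the measurements are not
  tied to the right-hand side of the linear system: for the trivial homomorphism every measurement
  has outcome \<open>0\<close> with certainty, which is a non-contextual distribution.\<close>

definition hinner :: "complex ^ 'n \<Rightarrow> complex ^ 'n \<Rightarrow> complex" where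
  "hinner u v = (\<Sum>i\<in>UNIV. cnj (u $ i) * v $ i)"

definition conj_transpose :: "complex ^ 'n ^ 'n \<Rightarrow> complex ^ 'n ^ 'n" where
  "conj_transpose U = (\<chi> i j. cnj (U $ j $ i))"

definition unitary_group :: "(complex ^ 'n ^ 'n) monoid" where
  "unitary_group =
     \<lparr>carrier = {U. U ** conj_transpose U = mat 1 \<and> conj_transpose U ** U = mat 1},
      monoid.mult = (**), one = mat 1\<rparr>"

definition density_operator :: "complex ^ 'n ^ 'n \<Rightarrow> bool" where
  "density_operator rho \<longleftrightarrow> (\<forall>v. hinner v (rho *v v) \<in> \<real>\<^sub>\<ge>\<^sub>0) \<and> trace rho = 1"

definition orth_projector :: "(complex ^ 'n) set \<Rightarrow> complex ^ 'n ^ 'n" where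
  "orth_projector S =
     (THE P. P ** P = P \<and> conj_transpose P = P \<and> range (\<lambda>v. P *v v) = S)"

definition omega :: "nat \<Rightarrow> complex" where
  "omega d = exp (2 * of_real pi * \<i> / of_nat d)"

definition joint_eigenspace ::
    "nat \<Rightarrow> (complex ^ 'n ^ 'n) list \<Rightarrow> int list \<Rightarrow> (complex ^ 'n) set" where
  "joint_eigenspace d Us as =
     {v. \<forall>i<length Us. (Us ! i) *v v = (omega d powi (as ! i)) *s v}"

text \<open>The trace below is real, being that of the product of a positive operator and a projector.\<close>

definition quantum_map ::
    "nat \<Rightarrow> ('g, 'm) monoid_scheme \<Rightarrow> ('g \<Rightarrow> complex ^ 'n ^ 'n) \<Rightarrow> complex ^ 'n ^ 'n \<Rightarrow>
     nat \<Rightarrow> 'g list \<Rightarrow> int list \<Rightarrow> real" where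
  "quantum_map d G chi rho n = (\<lambda>gs\<in>simplices (comm_nerve d G) n. \<lambda>as.
      if as \<in> simplices (nerve (integer_mod_group d)) n
      then Re (trace (rho ** orth_projector (joint_eigenspace d (map chi gs) as)))
      else 0)"

section \<open>Consistency of the definitions\<close>

lemma length_nerve_face: "length gs = Suc n \<Longrightarrow> i \<le> Suc n \<Longrightarrow> length (nerve_face G (Suc n) i gs) = n"
  by (auto simp: nerve_face_def)

lemma nth_nerve_face:
  assumes "length gs = Suc n" "i \<le> Suc n" "k < n"
  shows "nerve_face G (Suc n) i gs ! k =
    (if Suc k < i then gs ! k else if Suc k = i then gs ! k \<otimes>\<^bsub>G\<^esub> gs ! Suc k else gs ! Suc k)"
  using assms by (auto simp: nerve_face_def nth_tl nth_butlast nth_append min_def nth_Cons')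

lemma length_nerve_degen: "length (nerve_degen G n i gs) = Suc (length gs)"
  by (auto simp: nerve_degen_def)

lemma nth_nerve_degen:
  assumes "length gs = n" "i \<le> n" "k < Suc n"
  shows "nerve_degen G n i gs ! k = (if k < i then gs ! k else if k = i then \<one>\<^bsub>G\<^esub> else gs ! (k-1))"
  using assms by (auto simp: nerve_degen_def nth_append min_def nth_Cons')

lemma in_nerve: "gs \<in> simplices (nerve G) n \<longleftrightarrow> length gs = n \<and> (\<forall>k<n. gs ! k \<in> carrier G)"
  by (auto simp: nerve_def in_set_conv_nth subset_iff)

lemma nerve_sel [simp]: "face (nerve G) = nerve_face G" "degen (nerve G) = nerve_degen G"
  by (simp_all add: nerve_def)

lemma simplicial_set_nerve:
  assumes "monoid G" shows "simplicial_set (nerve G)"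
proof -
  interpret monoid G by fact
  note len = length_nerve_face length_nerve_degen
  note nth = nth_nerve_face nth_nerve_degen
  have face_face: "nerve_face G (Suc n) i (nerve_face G (Suc (Suc n)) (Suc j) gs)
      = nerve_face G (Suc n) j (nerve_face G (Suc (Suc n)) i gs)"
    if "gs \<in> simplices (nerve G) (Suc (Suc n))" "j \<le> Suc n" "i \<le> j" for n gs i j
  proof (rule nth_equalityI)
    fix k assume "k < length (nerve_face G (Suc n) i (nerve_face G (Suc (Suc n)) (Suc j) gs))"
    then have k: "k < n" using that by (simp add: in_nerve len)
    consider "Suc k < i" | "Suc k = i" "i < j" | "Suc k = i" "i = j" | "Suc k > i" "Suc k < j"
      | "Suc k > i" "Suc k = j" | "Suc k > j"
      using that(3) by (metis linorder_less_linear order_le_less)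
    then show "nerve_face G (Suc n) i (nerve_face G (Suc (Suc n)) (Suc j) gs) ! k
        = nerve_face G (Suc n) j (nerve_face G (Suc (Suc n)) i gs) ! k"
      using that k by cases (simp_all add: in_nerve len nth m_assoc)
  qed (use that in \<open>simp add: in_nerve len\<close>)
  have degen_degen: "nerve_degen G (Suc n) i (nerve_degen G n j gs)
      = nerve_degen G (Suc n) (Suc j) (nerve_degen G n i gs)"
    if "length gs = n" "j \<le> n" "i \<le> j" for n gs i j
    using that by (intro nth_equalityI) (auto simp: len nth)
  have face_degen: "nerve_face G (Suc n) j (nerve_degen G n j gs) = gs"
      "nerve_face G (Suc n) (Suc j) (nerve_degen G n j gs) = gs"
    if "gs \<in> simplices (nerve G) n" "j \<le> n" for n gs j
    using that by (auto simp: in_nerve len nth intro!: nth_equalityI)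
  have face_degen_less: "nerve_face G (Suc (Suc n)) i (nerve_degen G (Suc n) (Suc j) gs)
      = nerve_degen G n j (nerve_face G (Suc n) i gs)"
    if "length gs = Suc n" "j \<le> n" "i \<le> j" for n gs i j
    using that by (intro nth_equalityI) (auto simp: len nth)
  have face_degen_greater: "nerve_face G (Suc (Suc n)) (Suc i) (nerve_degen G (Suc n) j gs)
      = nerve_degen G n j (nerve_face G (Suc n) i gs)"
    if "length gs = Suc n" "j < i" "i \<le> Suc n" for n gs i j
    using that by (intro nth_equalityI) (auto simp: len nth)
  have mem: "nerve_face G (Suc n) i gs \<in> simplices (nerve G) n"
    if "gs \<in> simplices (nerve G) (Suc n)" "i \<le> Suc n" for n gs i
    using that by (auto simp: in_nerve len nth)
  have mem': "nerve_degen G n i gs \<in> simplices (nerve G) (Suc n)"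
    if "gs \<in> simplices (nerve G) n" "i \<le> n" for n gs i
    using that by (auto simp: in_nerve len nth)
  have Sucs: "\<exists>m. j = Suc m" if "i < j" for i j :: nat
    using that by (cases j) auto
  have length: "length gs = n" if "gs \<in> simplices (nerve G) n" for gs n
    using that by (simp add: in_nerve)
  show ?thesis
    unfolding simplicial_set_def nerve_sel
    apply (intro conjI allI ballI impI)
          apply (simp_all only: mem mem' face_degen)
       apply (metis Sucs face_face diff_Suc_1 Suc_le_mono less_Suc_eq_le)
      apply (metis degen_degen length)
     apply (metis Sucs face_degen_less diff_Suc_1 Suc_le_mono less_Suc_eq_le length)
    apply (elim conjE)
    subgoal for n gs j i
      by (cases i) (auto intro!: face_degen_greater simp: length)
    done
qed

lemma face_in_simplices:
  "simplicial_set X \<Longrightarrow> x \<in> simplices X (Suc n) \<Longrightarrow> i \<le> Suc n \<Longrightarrow> face X (Suc n) i x \<in> simplices X n"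
  by (simp add: simplicial_set_def)

lemma degen_in_simplices:
  "simplicial_set X \<Longrightarrow> x \<in> simplices X n \<Longrightarrow> i \<le> n \<Longrightarrow> degen X n i x \<in> simplices X (Suc n)"
  by (simp add: simplicial_set_def)

lemma simplicial_set_sub:
  assumes "simplicial_set X" "\<And>n. S n \<subseteq> simplices X n"
    and "\<And>n i x. x \<in> S (Suc n) \<Longrightarrow> i \<le> Suc n \<Longrightarrow> face X (Suc n) i x \<in> S n"
    and "\<And>n i x. x \<in> S n \<Longrightarrow> i \<le> n \<Longrightarrow> degen X n i x \<in> S (Suc n)"
  shows "simplicial_set (X\<lparr>simplices := S\<rparr>)"
  using assms unfolding simplicial_set_def by (simp add: subset_iff)

lemma set_nerve_face:
  assumes "length gs = Suc n" "i \<le> Suc n"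
  shows "set (nerve_face G (Suc n) i gs)
           \<subseteq> set gs \<union> {g \<otimes>\<^bsub>G\<^esub> h |g h. g \<in> set gs \<and> h \<in> set gs}"
proof
  fix x assume "x \<in> set (nerve_face G (Suc n) i gs)"
  then obtain k where k: "k < n" "x = nerve_face G (Suc n) i gs ! k"
    using assms by (auto simp: in_set_conv_nth length_nerve_face)
  have "gs ! k \<in> set gs" "gs ! Suc k \<in> set gs" using k assms by auto
  then show "x \<in> set gs \<union> {g \<otimes>\<^bsub>G\<^esub> h |g h. g \<in> set gs \<and> h \<in> set gs}"
    unfolding k(2) nth_nerve_face[OF assms k(1)] by auto
qed

lemma set_nerve_degen: "set (nerve_degen G n i gs) \<subseteq> insert \<one>\<^bsub>G\<^esub> (set gs)"
  by (auto simp: nerve_degen_def dest: in_set_takeD in_set_dropD)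

lemma simplicial_set_comm_nerve:
  assumes "group G" shows "simplicial_set (comm_nerve d G)"
proof -
  interpret group G by fact
  have nv: "simplicial_set (nerve G)" by (simp add: simplicial_set_nerve monoid_axioms)
  show ?thesis unfolding comm_nerve_def
  proof (rule simplicial_set_sub[OF nv], goal_cases)
    case (2 n i gs)
    then have len: "length gs = Suc n" and car: "\<And>g. g \<in> set gs \<Longrightarrow> g \<in> carrier G"
      and comm: "\<And>g h. g \<in> set gs \<Longrightarrow> h \<in> set gs \<Longrightarrow> g \<otimes>\<^bsub>G\<^esub> h = h \<otimes>\<^bsub>G\<^esub> g"
      and tor: "\<And>g. g \<in> set gs \<Longrightarrow> g [^]\<^bsub>G\<^esub> d = \<one>\<^bsub>G\<^esub>"
      by (auto simp: nerve_def)
    let ?P = "set gs \<union> {g \<otimes>\<^bsub>G\<^esub> h |g h. g \<in> set gs \<and> h \<in> set gs}"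
    have sub: "set (nerve_face G (Suc n) i gs) \<subseteq> ?P" using set_nerve_face len 2 by blast
    have c1: "x \<otimes>\<^bsub>G\<^esub> (g \<otimes>\<^bsub>G\<^esub> h) = (g \<otimes>\<^bsub>G\<^esub> h) \<otimes>\<^bsub>G\<^esub> x"
      if "x \<in> carrier G" "g \<in> carrier G" "h \<in> carrier G" "x \<otimes>\<^bsub>G\<^esub> g = g \<otimes>\<^bsub>G\<^esub> x" "x \<otimes>\<^bsub>G\<^esub> h = h \<otimes>\<^bsub>G\<^esub> x" for x g h
      using that by (metis m_assoc)
    have comm': "x \<otimes>\<^bsub>G\<^esub> y = y \<otimes>\<^bsub>G\<^esub> x" if "x \<in> ?P" "y \<in> set gs" for x y
      using that c1[of y] comm car by auto
    have P1: "x \<otimes>\<^bsub>G\<^esub> y = y \<otimes>\<^bsub>G\<^esub> x" if x: "x \<in> ?P" and y: "y \<in> ?P" for x y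
    proof (cases "y \<in> set gs")
      case False
      then obtain g h where "y = g \<otimes>\<^bsub>G\<^esub> h" "g \<in> set gs" "h \<in> set gs" using y by blast
      moreover have "x \<in> carrier G" using x car by auto
      ultimately show ?thesis using c1[of x g h] comm'[OF x] car by simp
    qed (use comm' x in blast)
    have P2: "x [^]\<^bsub>G\<^esub> d = \<one>\<^bsub>G\<^esub>" if "x \<in> ?P" for x
      using that tor car comm by (auto simp: pow_mult_distrib)
    have mem: "face (nerve G) (Suc n) i gs \<in> simplices (nerve G) n"
      using 2 by (intro face_in_simplices nv) auto
    have "\<forall>x\<in>set (nerve_face G (Suc n) i gs). \<forall>y\<in>set (nerve_face G (Suc n) i gs).
            x \<otimes>\<^bsub>G\<^esub> y = y \<otimes>\<^bsub>G\<^esub> x"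
      using P1 sub by (meson subsetD)
    moreover have "\<forall>x\<in>set (nerve_face G (Suc n) i gs). x [^]\<^bsub>G\<^esub> d = \<one>\<^bsub>G\<^esub>"
      using P2 sub by (meson subsetD)
    ultimately show ?case using mem by simp
  next
    case (3 n i gs)
    then have car: "\<And>g. g \<in> set gs \<Longrightarrow> g \<in> carrier G" by (auto simp: nerve_def)
    have mem: "degen (nerve G) n i gs \<in> simplices (nerve G) (Suc n)"
      using 3 by (intro degen_in_simplices nv) auto
    have P: "\<forall>x\<in>insert \<one>\<^bsub>G\<^esub> (set gs). \<forall>y\<in>insert \<one>\<^bsub>G\<^esub> (set gs). x \<otimes>\<^bsub>G\<^esub> y = y \<otimes>\<^bsub>G\<^esub> x"
      "\<forall>x\<in>insert \<one>\<^bsub>G\<^esub> (set gs). x [^]\<^bsub>G\<^esub> d = \<one>\<^bsub>G\<^esub>"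
      using 3 car by simp_all
    have "\<forall>x\<in>set (nerve_degen G n i gs). \<forall>y\<in>set (nerve_degen G n i gs).
            x \<otimes>\<^bsub>G\<^esub> y = y \<otimes>\<^bsub>G\<^esub> x"
      using P(1) set_nerve_degen by (meson subsetD)
    moreover have "\<forall>x\<in>set (nerve_degen G n i gs). x [^]\<^bsub>G\<^esub> d = \<one>\<^bsub>G\<^esub>"
      using P(2) set_nerve_degen by (meson subsetD)
    ultimately show ?case using mem by simp
  qed auto
qed

lemma simplicial_set_system_sset: "simplicial_set (system_sset d r c A)"
proof -
  let ?V = "vertex_functions d c"
  have nv: "simplicial_set (nerve ?V)"
    by (simp add: simplicial_set_nerve group.is_monoid vertex_functions_def)
  have down: "X \<in> support_complex r c A" if "Y \<in> support_complex r c A" "X \<subseteq> Y" for X Y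
    using that unfolding support_complex_def by (auto simp: subset_singleton_iff) blast+
  have supp_mult: "supp c (s \<otimes>\<^bsub>?V\<^esub> t) \<subseteq> supp c s \<union> supp c t" for s t
    by (auto simp: supp_def vertex_functions_def)
  have supp_one: "supp c \<one>\<^bsub>?V\<^esub> = {}"
    by (auto simp: supp_def vertex_functions_def)
  show ?thesis unfolding system_sset_def
  proof (rule simplicial_set_sub[OF nv], goal_cases)
    case (2 n i ss)
    then have len: "length ss = Suc n" by (simp add: nerve_def)
    have "supp c s \<subseteq> (\<Union>s\<in>set ss. supp c s)" if "s \<in> set (nerve_face ?V (Suc n) i ss)" for s
    proof -
      have "s \<in> set ss \<union> {g \<otimes>\<^bsub>?V\<^esub> h |g h. g \<in> set ss \<and> h \<in> set ss}"
        using subsetD[OF set_nerve_face[OF len 2(2)] that] .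
      then consider "s \<in> set ss" | g h where "s = g \<otimes>\<^bsub>?V\<^esub> h" "g \<in> set ss" "h \<in> set ss"
        by blast
      then show ?thesis
      proof cases
        case 2
        have "supp c g \<union> supp c h \<subseteq> (\<Union>s\<in>set ss. supp c s)"
          using 2(2,3) by (intro Un_least UN_upper)
        then show ?thesis using supp_mult[of g h] 2(1) by (simp only: order_trans)
      qed auto
    qed
    then have sub: "(\<Union>s\<in>set (nerve_face ?V (Suc n) i ss). supp c s) \<subseteq> (\<Union>s\<in>set ss. supp c s)"
      by (rule UN_least)
    have "(\<Union>s\<in>set (nerve_face ?V (Suc n) i ss). supp c s) \<in> support_complex r c A"
      by (rule down[OF _ sub]) (use 2(1) in simp)
    moreover have "face (nerve ?V) (Suc n) i ss \<in> simplices (nerve ?V) n"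
      using 2 by (intro face_in_simplices nv) auto
    ultimately show ?case by simp
  next
    case (3 n i ss)
    have "(\<Union>s\<in>set (nerve_degen ?V n i ss). supp c s)
            \<subseteq> (\<Union>s\<in>insert \<one>\<^bsub>?V\<^esub> (set ss). supp c s)"
      by (rule UN_mono[OF set_nerve_degen]) simp
    also have "\<dots> = (\<Union>s\<in>set ss. supp c s)"
      by (simp add: supp_one)
    finally have sub: "(\<Union>s\<in>set (nerve_degen ?V n i ss). supp c s) \<subseteq> \<dots>" .
    have "(\<Union>s\<in>set (nerve_degen ?V n i ss). supp c s) \<in> support_complex r c A"
      by (rule down[OF _ sub]) (use 3(1) in simp)
    moreover have "degen (nerve ?V) n i ss \<in> simplices (nerve ?V) (Suc n)"
      using 3 by (intro degen_in_simplices nv) auto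
    ultimately show ?case by simp
  qed auto
qed

lemma push_dist_supp:
  assumes "p \<in> dist_on U"
  shows "{v. push_dist f p v \<noteq> 0} = f ` {u. p u \<noteq> 0}"
proof -
  have "push_dist f p v \<noteq> 0 \<longleftrightarrow> (\<exists>u. p u \<noteq> 0 \<and> f u = v)" for v
  proof -
    have "finite {u. p u \<noteq> 0 \<and> f u = v}" using assms
      by (auto simp: dist_on_def elim: rev_finite_subset)
    then show ?thesis using assms unfolding push_dist_def dist_on_def
      by (subst sum_nonneg_eq_0_iff) auto
  qed
  then show ?thesis by auto
qed

lemma push_dist_in:
  assumes p: "p \<in> dist_on U" and f: "\<And>u. u \<in> U \<Longrightarrow> f u \<in> V"
  shows "push_dist f p \<in> dist_on V"
proof -
  have fin: "finite {u. p u \<noteq> 0}" using p by (simp add: dist_on_def)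
  have "(\<Sum>v\<in>f ` {u. p u \<noteq> 0}. push_dist f p v) = (\<Sum>u\<in>{u. p u \<noteq> 0}. p u)"
    unfolding push_dist_def using sum.image_gen[OF fin, of p f] by simp
  moreover have "0 \<le> push_dist f p v" for v
    using p by (auto simp: push_dist_def dist_on_def intro!: sum_nonneg)
  moreover have "f ` {u. p u \<noteq> 0} \<subseteq> V" using p f by (auto simp: dist_on_def)
  ultimately show ?thesis using p fin
    by (simp add: dist_on_def push_dist_supp[OF p])
qed

lemma push_dist_comp:
  assumes p: "p \<in> dist_on U"
  shows "push_dist g (push_dist f p) = push_dist (\<lambda>u. g (f u)) p"
proof
  fix w
  have fin: "finite {u. p u \<noteq> 0}" using p by (simp add: dist_on_def)
  let ?S = "{u. p u \<noteq> 0 \<and> g (f u) = w}"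
  have finS: "finite ?S" using fin by (rule rev_finite_subset) auto
  have "{v. push_dist f p v \<noteq> 0 \<and> g v = w} = f ` ?S"
    using push_dist_supp[OF p, of f] by auto
  then have "push_dist g (push_dist f p) w = (\<Sum>v\<in>f ` ?S. push_dist f p v)"
    by (simp add: push_dist_def[of g])
  also have "\<dots> = (\<Sum>v\<in>f ` ?S. \<Sum>u\<in>{u\<in>?S. f u = v}. p u)"
    by (rule sum.cong) (auto simp: push_dist_def intro!: sum.cong)
  also have "\<dots> = push_dist (\<lambda>u. g (f u)) p w"
    using sum.image_gen[OF finS, of p f] by (simp add: push_dist_def)
  finally show "push_dist g (push_dist f p) w = push_dist (\<lambda>u. g (f u)) p w" .
qed

lemma push_dist_cong:
  assumes "p \<in> dist_on U" "\<And>u. u \<in> U \<Longrightarrow> f u = g u"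
  shows "push_dist f p = push_dist g p"
  using assms by (auto simp: push_dist_def dist_on_def fun_eq_iff intro!: sum.cong)

lemma push_dist_id:
  assumes "p \<in> dist_on U" "\<And>u. u \<in> U \<Longrightarrow> f u = u"
  shows "push_dist f p = p"
proof
  fix v
  have "{u. p u \<noteq> 0 \<and> f u = v} = (if p v \<noteq> 0 then {v} else {})"
    using assms by (auto simp: dist_on_def subset_iff)
  then show "push_dist f p v = p v" by (auto simp: push_dist_def)
qed

lemma simplicial_set_dist_sset:
  assumes "simplicial_set Y" shows "simplicial_set (dist_sset Y)"
  using assms unfolding simplicial_set_def dist_sset_def
  apply (elim conjE)
  apply (intro conjI allI ballI impI)
        apply (simp_all add: push_dist_comp)
        apply (auto intro!: push_dist_cong push_dist_id push_dist_in)
  done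

lemma conj_transpose_mult: "conj_transpose (U ** V) = conj_transpose V ** conj_transpose U"
  by (simp add: conj_transpose_def matrix_matrix_mult_def vec_eq_iff mult.commute)
lemma conj_transpose_conj_transpose: "conj_transpose (conj_transpose U) = U"
  by (simp add: conj_transpose_def vec_eq_iff)
lemma conj_transpose_mat_1: "conj_transpose (mat 1) = mat 1"
  by (auto simp add: conj_transpose_def vec_eq_iff mat_def)

lemma group_unitary_group: "group unitary_group"
proof (rule groupI)
  fix x y :: "complex^'n^'n" assume "x \<in> carrier unitary_group" "y \<in> carrier unitary_group"
  then show "x \<otimes>\<^bsub>unitary_group\<^esub> y \<in> carrier unitary_group"
    by (simp add: unitary_group_def conj_transpose_mult) (metis matrix_mul_assoc matrix_mul_lid)
next
  fix x :: "complex^'n^'n" assume "x \<in> carrier unitary_group"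
  then show "\<exists>y\<in>carrier unitary_group. y \<otimes>\<^bsub>unitary_group\<^esub> x = \<one>\<^bsub>unitary_group\<^esub>"
    by (intro bexI[of _ "conj_transpose x"]) (auto simp: unitary_group_def conj_transpose_conj_transpose)
qed (auto simp: unitary_group_def conj_transpose_mat_1 matrix_mul_assoc)

lemma foldr_integer_mod_group:
  assumes "0 < d"
  shows "foldr (\<lambda>j x. F j \<otimes>\<^bsub>integer_mod_group d\<^esub> x) js \<one>\<^bsub>integer_mod_group d\<^esub>
           = sum_list (map F js) mod int d"
  by (induction js) (auto simp: mod_add_right_eq)

lemma is_solution_integer_mod_group:
  assumes "1 < d"
  shows "is_solution d r c A b (integer_mod_group d) 1 x \<longleftrightarrow>
    (\<forall>j<c. x j \<in> {0..<int d}) \<and> (\<forall>i<r. (\<Sum>j<c. A i j * x j) mod int d = b i mod int d)"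
proof -
  let ?Z = "integer_mod_group d"
  have "vertex_prod ?Z (\<lambda>j. x j [^]\<^bsub>?Z\<^esub> A i j) (row_support c A i)
          = (\<Sum>j<c. A i j * x j) mod int d" for i
  proof -
    have fin: "finite (row_support c A i)" by (simp add: row_support_def)
    have "vertex_prod ?Z (\<lambda>j. x j [^]\<^bsub>?Z\<^esub> A i j) (row_support c A i)
      = (\<Sum>j\<in>row_support c A i. (A i j * x j) mod int d) mod int d"
      unfolding vertex_prod_def using assms
      by (subst foldr_integer_mod_group)
        (auto simp: int_pow_integer_mod_group sum_list_distinct_conv_sum_set fin)
    also have "\<dots> = (\<Sum>j\<in>row_support c A i. A i j * x j) mod int d" by (simp add: mod_sum_eq)
    also have "(\<Sum>j\<in>row_support c A i. A i j * x j) = (\<Sum>j<c. A i j * x j)"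
      by (rule sum.mono_neutral_left) (auto simp: row_support_def)
    finally show ?thesis .
  qed
  then show ?thesis using assms
    by (auto simp: is_solution_def int_pow_integer_mod_group carrier_integer_mod_group add.commute)
qed

end

theory Submission
  imports Defs
begin

text \<open>A non-contextual distribution is a mixture of deterministic
  ones, so some simplicial map \<open>s\<close> from the source to the nerve of \<open>\<int>\<^sub>d\<close> takes, on every simplex, a
  value that has positive probability (\<open>noncontextual_possible_map\<close>).  Such a map is additive on edges
  that span a simplex (\<open>simplicial_map_edge_mult\<close>).  The functions supported on one row of the system
  all span simplices with each other, so the value of \<open>s\<close> on the row \<open>A\<^sub>i\<close> is the sum of the
  \<open>A\<^sub>i\<^sub>j x\<^sub>j\<close>, where \<open>x\<^sub>j\<close> is its value on the indicator function of the \<open>j\<close>-th vertex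
  (\<open>simplicial_map_row\<close>).  On the other hand, the solution map sends \<open>A\<^sub>i\<close> to the power of \<open>J\<close> with
  exponent \<open>b\<^sub>i\<close>, which is represented by a scalar, whence its measurement yields \<open>b\<^sub>i\<close> with certainty
  (\<open>central_power_outcome\<close>).  Being possible, the value of \<open>s\<close> on \<open>A\<^sub>i\<close> is therefore \<open>b\<^sub>i\<close>, and \<open>x\<close>
  is a solution in \<open>\<int>\<^sub>d\<close>, contrary to the hypothesis.

  Contextuality also includes that the composite is a simplicial distribution in the first place.  The
  solution map is simplicial because vertices of a common simplex are sent to commuting elements of
  order dividing \<open>d\<close> (\<open>solution_map_simplicial\<close>).  For the measurement map
  (\<open>quantum_map_simplicial\<close>), the joint eigenspaces of commuting unitary operators of order dividing
  \<open>d\<close> form an orthogonal decomposition of the space, and a joint eigenvector for a tuple is one for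
  each of its faces and degeneracies, with the corresponding face or degeneracy of the eigenvalues.
  Thus every structure map turns one decomposition into a coarser one, whose projectors are sums of
  those of the finer one (\<open>orth_projector_coarsen\<close>); this is precisely the statement that structure
  maps sum probabilities over fibres.\<close>

section \<open>Simplicial maps and non-contextuality\<close>

lemma comp_map_simplicial:
  assumes "simplicial_set X" "f \<in> simplicial_maps X Y" "g \<in> simplicial_maps Y Z"
  shows "comp_map X g f \<in> simplicial_maps X Z"
proof -
  have f: "f n x \<in> simplices Y n" if "x \<in> simplices X n" for n x
    using assms(2) that by (auto simp: simplicial_maps_def)
  have g: "g n y \<in> simplices Z n" if "y \<in> simplices Y n" for n y
    using assms(3) that by (auto simp: simplicial_maps_def)
  have fX: "face X (Suc n) i x \<in> simplices X n" if "x \<in> simplices X (Suc n)" "i \<le> Suc n" for n i x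
    using face_in_simplices[OF assms(1) that] .
  have dX: "degen X n i x \<in> simplices X (Suc n)" if "x \<in> simplices X n" "i \<le> n" for n i x
    using degen_in_simplices[OF assms(1) that] .
  show ?thesis
    using assms(2,3) f g fX dX
    by (auto simp: simplicial_maps_def comp_map_def compose_eq intro!: PiE_I simp: compose_def)
qed

text \<open>Any deterministic map in the support of the mixture will do: all weights are nonnegative, so its
  own weight is a lower bound for the probability of each of its values.\<close>

lemma noncontextual_possible_map:
  assumes "noncontextual X Y p"
  shows "\<exists>s\<in>simplicial_maps X Y. \<forall>n. \<forall>x\<in>simplices X n. 0 < p n x (s n x)"
proof -
  obtain lam where lam: "lam \<in> dist_on (simplicial_maps X Y)"
    and p: "\<And>n x y. x \<in> simplices X n \<Longrightarrow> y \<in> simplices Y n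
              \<Longrightarrow> p n x y = (\<Sum>s\<in>{s. lam s \<noteq> 0 \<and> s n x = y}. lam s)"
    using assms by (auto simp: noncontextual_def)
  have fin: "finite {s. lam s \<noteq> 0}" and nonneg: "0 \<le> lam s" for s
    using lam by (auto simp: dist_on_def)
  have "(\<Sum>s\<in>{s. lam s \<noteq> 0}. lam s) \<noteq> 0" using lam by (simp add: dist_on_def)
  then have "{s. lam s \<noteq> 0} \<noteq> {}" by (metis sum.empty)
  then obtain s where s: "lam s \<noteq> 0" by auto
  then have sm: "s \<in> simplicial_maps X Y" using lam by (auto simp: dist_on_def)
  have "0 < p n x (s n x)" if x: "x \<in> simplices X n" for n x
  proof -
    have "s n x \<in> simplices Y n" using sm x by (auto simp: simplicial_maps_def)
    then have "p n x (s n x) = (\<Sum>t\<in>{t. lam t \<noteq> 0 \<and> t n x = s n x}. lam t)" using p x by simp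
    moreover have "finite {t. lam t \<noteq> 0 \<and> t n x = s n x}"
      using fin by (rule rev_finite_subset) auto
    then have "0 < (\<Sum>t\<in>{t. lam t \<noteq> 0 \<and> t n x = s n x}. lam t)"
      using s nonneg[of s] nonneg by (intro sum_pos2[of _ s]) (auto simp: less_le)
    ultimately show ?thesis by simp
  qed
  with sm show ?thesis by blast
qed

text \<open>The three faces of the \<open>2\<close>-simplex \<open>[u, v]\<close> are its two entries and their product, and in a nerve
  the middle face is likewise determined by the outer two.  So a simplicial map into a nerve is
  multiplicative on every pair of edges that spans a simplex of the source.\<close>

lemma simplicial_map_edge_mult:
  assumes s: "s \<in> simplicial_maps X (nerve H)" and X: "face X = nerve_face V"
    and uv: "[u, v] \<in> simplices X (Suc (Suc 0))"
  shows "hd (s (Suc 0) [u \<otimes>\<^bsub>V\<^esub> v]) = hd (s (Suc 0) [u]) \<otimes>\<^bsub>H\<^esub> hd (s (Suc 0) [v])"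
proof -
  have "s (Suc (Suc 0)) [u, v] \<in> simplices (nerve H) (Suc (Suc 0))"
    using s uv by (auto simp: simplicial_maps_def)
  then obtain a b where ab: "s (Suc (Suc 0)) [u, v] = [a, b]"
    by (auto simp: nerve_def length_Suc_conv)
  have face: "s (Suc 0) (nerve_face V (Suc (Suc 0)) i [u, v]) = nerve_face H (Suc (Suc 0)) i [a, b]"
    if "i \<le> Suc (Suc 0)" for i
    using s uv that ab X by (auto simp: simplicial_maps_def)
  show ?thesis
    using face[of 0] face[of "Suc 0"] face[of "Suc (Suc 0)"] by (simp add: nerve_face_def)
qed

lemma simplicial_map_edge_one:
  assumes s: "s \<in> simplicial_maps X (nerve H)" and X: "[] \<in> simplices X 0" "degen X = nerve_degen V"
  shows "hd (s (Suc 0) [\<one>\<^bsub>V\<^esub>]) = \<one>\<^bsub>H\<^esub>"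
proof -
  have "s 0 [] = []" using s X by (auto simp: simplicial_maps_def nerve_def)
  moreover have "s (Suc 0) (degen X 0 0 []) = nerve_degen H 0 0 (s 0 [])"
    using s X(1) by (auto simp: simplicial_maps_def)
  ultimately show ?thesis by (simp add: X(2) nerve_degen_def)
qed

lemma map_nerve_face:
  assumes "length gs = Suc n" "i \<le> Suc n"
    and "\<And>g h. g \<in> set gs \<Longrightarrow> h \<in> set gs \<Longrightarrow> f (g \<otimes>\<^bsub>G\<^esub> h) = f g \<otimes>\<^bsub>H\<^esub> f h"
  shows "map f (nerve_face G (Suc n) i gs) = nerve_face H (Suc n) i (map f gs)"
  using assms by (intro nth_equalityI) (auto simp: length_nerve_face nth_nerve_face)

lemma map_nerve_degen:
  assumes "f \<one>\<^bsub>G\<^esub> = \<one>\<^bsub>H\<^esub>"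
  shows "map f (nerve_degen G n i gs) = nerve_degen H n i (map f gs)"
  using assms by (simp add: nerve_degen_def take_map drop_map)

section \<open>Products of commuting elements\<close>

lemma (in monoid) foldr_mult_closed:
  assumes "\<And>j. j \<in> set js \<Longrightarrow> F j \<in> carrier G"
  shows "foldr (\<lambda>j x. F j \<otimes> x) js \<one> \<in> carrier G"
  using assms by (induction js) auto

lemma (in monoid) foldr_mult_commute:
  assumes "g \<in> carrier G" "\<And>j. j \<in> set js \<Longrightarrow> F j \<in> carrier G"
    and "\<And>j. j \<in> set js \<Longrightarrow> g \<otimes> F j = F j \<otimes> g"
  shows "g \<otimes> foldr (\<lambda>j x. F j \<otimes> x) js \<one> = foldr (\<lambda>j x. F j \<otimes> x) js \<one> \<otimes> g"
  using assms(2,3)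
proof (induction js)
  case (Cons k js)
  have "foldr (\<lambda>j x. F j \<otimes> x) js \<one> \<in> carrier G"
    using Cons.prems by (intro foldr_mult_closed) auto
  then show ?case
    using Cons.IH Cons.prems assms(1) by simp (metis m_assoc)
qed (use assms(1) in simp)

lemma (in monoid) foldr_mult_distrib:
  assumes "\<And>j. j \<in> set js \<Longrightarrow> E j \<in> carrier G" "\<And>j. j \<in> set js \<Longrightarrow> F j \<in> carrier G"
    and "\<And>j k. j \<in> set js \<Longrightarrow> k \<in> set js \<Longrightarrow> E j \<otimes> F k = F k \<otimes> E j"
  shows "foldr (\<lambda>j x. (E j \<otimes> F j) \<otimes> x) js \<one>
           = foldr (\<lambda>j x. E j \<otimes> x) js \<one> \<otimes> foldr (\<lambda>j x. F j \<otimes> x) js \<one>"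
  using assms
proof (induction js)
  case (Cons k js)
  let ?P = "\<lambda>F. foldr (\<lambda>j x. F j \<otimes> x) js \<one>"
  have car: "?P E \<in> carrier G" "?P F \<in> carrier G" "E k \<in> carrier G" "F k \<in> carrier G"
    using Cons.prems by (auto intro!: foldr_mult_closed)
  have com: "F k \<otimes> ?P E = ?P E \<otimes> F k"
    using Cons.prems by (intro foldr_mult_commute) auto
  have "(E k \<otimes> F k) \<otimes> (?P E \<otimes> ?P F) = E k \<otimes> (F k \<otimes> ?P E) \<otimes> ?P F"
    using car by (simp add: m_assoc)
  also have "\<dots> = (E k \<otimes> ?P E) \<otimes> (F k \<otimes> ?P F)"
    unfolding com using car by (simp add: m_assoc)
  finally show ?case using Cons by simp
qed simp

lemma (in monoid) foldr_mult_pow: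
  assumes "\<And>j. j \<in> set js \<Longrightarrow> F j \<in> carrier G"
    and "\<And>j k. j \<in> set js \<Longrightarrow> k \<in> set js \<Longrightarrow> F j \<otimes> F k = F k \<otimes> F j"
  shows "foldr (\<lambda>j x. F j \<otimes> x) js \<one> [^] (n::nat) = foldr (\<lambda>j x. F j [^] n \<otimes> x) js \<one>"
  using assms
proof (induction js)
  case (Cons k js)
  have "F k \<otimes> foldr (\<lambda>j x. F j \<otimes> x) js \<one> = foldr (\<lambda>j x. F j \<otimes> x) js \<one> \<otimes> F k"
    using Cons.prems by (intro foldr_mult_commute) auto
  moreover have "foldr (\<lambda>j x. F j \<otimes> x) js \<one> \<in> carrier G"
    using Cons.prems by (intro foldr_mult_closed) auto
  ultimately show ?case using Cons pow_mult_distrib[of "F k" "foldr (\<lambda>j x. F j \<otimes> x) js \<one>" n] by simp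
qed simp

text \<open>Padding the product with trivial factors lets products over different supports be compared
  factor by factor.\<close>

lemma (in monoid) vertex_prod_extend:
  assumes "S \<subseteq> {..<c}" "\<And>j. j < c \<Longrightarrow> F j \<in> carrier G" "\<And>j. j < c \<Longrightarrow> j \<notin> S \<Longrightarrow> F j = \<one>"
  shows "vertex_prod G F S = foldr (\<lambda>j x. F j \<otimes> x) [0..<c] \<one>"
proof -
  have drop: "foldr (\<lambda>j x. F j \<otimes> x) (filter (\<lambda>j. j \<in> S) js) \<one> = foldr (\<lambda>j x. F j \<otimes> x) js \<one>"
    if "set js \<subseteq> {..<c}" for js
    using that
  proof (induction js)
    case (Cons k js)
    have "foldr (\<lambda>j x. F j \<otimes> x) js \<one> \<in> carrier G"
      using Cons.prems assms(2) by (intro foldr_mult_closed) auto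
    then show ?case using Cons assms(3) by auto
  qed simp
  have "sorted_list_of_set S = filter (\<lambda>j. j \<in> S) [0..<c]"
  proof (rule sorted_distinct_set_unique)
    show "set (sorted_list_of_set S) = set (filter (\<lambda>j. j \<in> S) [0..<c])"
      using assms(1) finite_subset[OF assms(1)] by auto
  qed (use sorted_filter[where f = "\<lambda>x::nat. x" and xs = "[0..<c]"] in auto)
  then show ?thesis using drop[of "[0..<c]"] by (simp add: vertex_prod_def atLeast0LessThan)
qed

lemma int_pow_commute:
  fixes m n :: int
  assumes "group G" "x \<in> carrier G" "y \<in> carrier G" "x \<otimes>\<^bsub>G\<^esub> y = y \<otimes>\<^bsub>G\<^esub> x" "0 \<le> m" "0 \<le> n"
  shows "x [^]\<^bsub>G\<^esub> m \<otimes>\<^bsub>G\<^esub> y [^]\<^bsub>G\<^esub> n = y [^]\<^bsub>G\<^esub> n \<otimes>\<^bsub>G\<^esub> x [^]\<^bsub>G\<^esub> m"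
proof -
  interpret group G by fact
  have "x [^]\<^bsub>G\<^esub> nat m \<otimes>\<^bsub>G\<^esub> y = y \<otimes>\<^bsub>G\<^esub> x [^]\<^bsub>G\<^esub> nat m"
    using assms by (intro group_commutes_pow)
  then have "y [^]\<^bsub>G\<^esub> nat n \<otimes>\<^bsub>G\<^esub> x [^]\<^bsub>G\<^esub> nat m = x [^]\<^bsub>G\<^esub> nat m \<otimes>\<^bsub>G\<^esub> y [^]\<^bsub>G\<^esub> nat n"
    using assms by (intro group_commutes_pow) auto
  then show ?thesis using assms by (simp add: pow_nat)
qed

lemma int_pow_mod:
  assumes "group G" "x \<in> carrier G" "x [^]\<^bsub>G\<^esub> d = \<one>\<^bsub>G\<^esub>"
  shows "x [^]\<^bsub>G\<^esub> (m mod int d) = x [^]\<^bsub>G\<^esub> m"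
proof -
  interpret group G by fact
  have "x [^]\<^bsub>G\<^esub> m = x [^]\<^bsub>G\<^esub> (int d * (m div int d) + m mod int d)" by simp
  also have "\<dots> = (x [^]\<^bsub>G\<^esub> int d) [^]\<^bsub>G\<^esub> (m div int d) \<otimes>\<^bsub>G\<^esub> x [^]\<^bsub>G\<^esub> (m mod int d)"
    using assms(2) by (simp only: int_pow_mult int_pow_pow)
  also have "\<dots> = x [^]\<^bsub>G\<^esub> (m mod int d)"
    using assms(2,3) by (simp add: int_pow_int)
  finally show ?thesis ..
qed

section \<open>The map of a solution\<close>

definition monomial :: "nat \<Rightarrow> ('g, 'm) monoid_scheme \<Rightarrow> (nat \<Rightarrow> 'g) \<Rightarrow> (nat \<Rightarrow> int) \<Rightarrow> 'g" where
  "monomial c G T s = vertex_prod G (\<lambda>j. T j [^]\<^bsub>G\<^esub> s j) (supp c s)"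

locale system_solution = group G for G (structure) +
  fixes d r c :: nat and A :: "nat \<Rightarrow> nat \<Rightarrow> int" and b :: "nat \<Rightarrow> int" and J :: 'a and T :: "nat \<Rightarrow> 'a"
  assumes d: "0 < d" and solution: "is_solution d r c A b G J T"
begin

lemma T_closed [simp]: "v < c \<Longrightarrow> T v \<in> carrier G" and T_pow: "v < c \<Longrightarrow> T v [^] d = \<one>"
  using solution by (auto simp: is_solution_def)

lemma vertex_functions_range:
  assumes "s \<in> carrier (vertex_functions d c)" "j < c"
  shows "0 \<le> s j" "s j < int d"
  using assms d by (auto simp: vertex_functions_def carrier_integer_mod_group PiE_iff)

lemma monomial_eq:
  "monomial c G T s = foldr (\<lambda>j x. T j [^] s j \<otimes> x) [0..<c] \<one>"
  unfolding monomial_def by (rule vertex_prod_extend) (auto simp: supp_def)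

lemma monomial_closed: "monomial c G T s \<in> carrier G"
  unfolding monomial_eq by (rule foldr_mult_closed) auto

lemma commuting_vertices:
  assumes "X \<in> support_complex r c A" "u \<in> X" "v \<in> X"
  shows "T u \<otimes> T v = T v \<otimes> T u"
  using assms solution unfolding support_complex_def is_solution_def by blast

text \<open>Outside the supports the powers are trivial, so all pairs of vertices are covered and not just
  those in \<open>X\<close>.\<close>

lemma power_commute:
  assumes "s \<in> carrier (vertex_functions d c)" "t \<in> carrier (vertex_functions d c)"
    and "supp c s \<subseteq> X" "supp c t \<subseteq> X" "X \<in> support_complex r c A" "j < c" "k < c"
  shows "T j [^] s j \<otimes> T k [^] t k = T k [^] t k \<otimes> T j [^] s j"
proof (cases "s j = 0 \<or> t k = 0")
  case False
  then have "j \<in> X" "k \<in> X" using assms by (auto simp: supp_def)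
  then show ?thesis using assms commuting_vertices[of X j k] vertex_functions_range
    by (intro int_pow_commute is_group) auto
qed (use assms in auto)

lemma monomial_commute:
  assumes "s \<in> carrier (vertex_functions d c)" "t \<in> carrier (vertex_functions d c)"
    and "supp c s \<subseteq> X" "supp c t \<subseteq> X" "X \<in> support_complex r c A"
  shows "monomial c G T s \<otimes> monomial c G T t = monomial c G T t \<otimes> monomial c G T s"
  unfolding monomial_eq[of t]
proof (rule foldr_mult_commute[OF monomial_closed])
  fix k assume "k \<in> set [0..<c]"
  then have "T k [^] t k \<otimes> monomial c G T s = monomial c G T s \<otimes> T k [^] t k"
    unfolding monomial_eq using assms power_commute[of t s X]
    by (intro foldr_mult_commute) auto
  then show "monomial c G T s \<otimes> T k [^] t k = T k [^] t k \<otimes> monomial c G T s" ..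
qed auto

lemma monomial_pow:
  assumes "s \<in> carrier (vertex_functions d c)" "supp c s \<in> support_complex r c A"
  shows "monomial c G T s [^] d = \<one>"
proof -
  have "monomial c G T s [^] d = foldr (\<lambda>j x. (T j [^] s j) [^] d \<otimes> x) [0..<c] \<one>"
    unfolding monomial_eq using power_commute[OF assms(1,1) _ _ assms(2)]
    by (intro foldr_mult_pow) auto
  also have "\<dots> = foldr (\<lambda>j x. \<one> \<otimes> x) [0..<c] \<one>"
  proof (rule foldr_cong)
    fix j x assume "j \<in> set [0..<c]"
    then have j: "j < c" by simp
    have "(T j [^] s j) [^] int d = (T j [^] int d) [^] s j"
      using j by (simp add: int_pow_pow mult.commute)
    then show "(T j [^] s j) [^] d \<otimes> x = \<one> \<otimes> x" using T_pow[OF j] by (simp add: int_pow_int)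
  qed auto
  also have "\<dots> = \<one>" by (induction c) auto
  finally show ?thesis .
qed

text \<open>The sum of \<open>s\<close> and \<open>t\<close> is reduced modulo \<open>d\<close>, which is harmless because \<open>T v\<close> has order
  dividing \<open>d\<close>; the factors can be rearranged because both supports lie in one simplex.\<close>

lemma monomial_mult:
  assumes "s \<in> carrier (vertex_functions d c)" "t \<in> carrier (vertex_functions d c)"
    and "supp c s \<subseteq> X" "supp c t \<subseteq> X" "X \<in> support_complex r c A"
  shows "monomial c G T (s \<otimes>\<^bsub>vertex_functions d c\<^esub> t) = monomial c G T s \<otimes> monomial c G T t"
proof -
  have "monomial c G T (s \<otimes>\<^bsub>vertex_functions d c\<^esub> t)
          = foldr (\<lambda>j x. (T j [^] s j \<otimes> T j [^] t j) \<otimes> x) [0..<c] \<one>"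
    unfolding monomial_eq
    by (intro foldr_cong)
      (auto simp: vertex_functions_def int_pow_mod[OF is_group _ T_pow] int_pow_mult)
  also have "\<dots> = monomial c G T s \<otimes> monomial c G T t"
    unfolding monomial_eq using assms power_commute[OF assms]
    by (intro foldr_mult_distrib) auto
  finally show ?thesis .
qed

lemma monomial_one: "monomial c G T \<one>\<^bsub>vertex_functions d c\<^esub> = \<one>"
proof -
  have "supp c \<one>\<^bsub>vertex_functions d c\<^esub> = {}" by (auto simp: supp_def vertex_functions_def)
  then show ?thesis by (simp add: monomial_def vertex_prod_def)
qed

lemma monomial_row:
  assumes "i < r"
  shows "monomial c G T (row_function c A i) = J [^] b i"
proof -
  have row: "supp c (row_function c A i) = row_support c A i"
    by (auto simp: supp_def row_function_def row_support_def)
  have "\<forall>j\<in>set (sorted_list_of_set (row_support c A i)). j < c"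
    by (auto simp: row_support_def)
  then have "monomial c G T (row_function c A i) = vertex_prod G (\<lambda>j. T j [^] A i j) (row_support c A i)"
    unfolding monomial_def row vertex_prod_def
    by (intro foldr_cong) (auto simp: row_function_def)
  then show ?thesis using solution assms by (simp add: is_solution_def)
qed

lemma solution_map_simplicial:
  "solution_map d r c A G T \<in> simplicial_maps (system_sset d r c A) (comm_nerve d G)"
proof -
  let ?V = "vertex_functions d c"
  let ?m = "monomial c G T"
  let ?X = "system_sset d r c A"
  have X: "length ss = n" "set ss \<subseteq> carrier ?V" "(\<Union>s\<in>set ss. supp c s) \<in> support_complex r c A"
    if "ss \<in> simplices ?X n" for ss n
    using that by (auto simp: system_sset_def nerve_def)
  have supp_sub: "supp c s \<subseteq> (\<Union>s\<in>set ss. supp c s)" if "s \<in> set ss" for s ss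
    using that by blast
  have single: "supp c s \<in> support_complex r c A" if "ss \<in> simplices ?X n" "s \<in> set ss" for s ss n
    using X(3)[OF that(1)] supp_sub[OF that(2)]
    unfolding support_complex_def by (auto simp: subset_singleton_iff) blast+
  have eq: "solution_map d r c A G T n ss = map ?m ss" if "ss \<in> simplices ?X n" for ss n
    using that by (simp add: solution_map_def monomial_def)
  have ops: "face ?X = nerve_face ?V" "degen ?X = nerve_degen ?V"
    "face (comm_nerve d G) = nerve_face G" "degen (comm_nerve d G) = nerve_degen G"
    by (simp_all add: system_sset_def comm_nerve_def)
  note sX = simplicial_set_system_sset[of d r c A]
  show ?thesis unfolding simplicial_maps_def
  proof (intro CollectI conjI allI ballI impI)
    fix n
    show "solution_map d r c A G T n \<in> simplices ?X n \<rightarrow>\<^sub>E simplices (comm_nerve d G) n"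
    proof (rule PiE_I)
      fix ss assume ss: "ss \<in> simplices ?X n"
      note X' = X[OF ss]
      have "map ?m ss \<in> simplices (comm_nerve d G) n"
        using X' monomial_closed monomial_commute[OF _ _ supp_sub supp_sub X'(3)]
          monomial_pow single[OF ss]
        by (auto simp: comm_nerve_def nerve_def subset_iff)
      then show "solution_map d r c A G T n ss \<in> simplices (comm_nerve d G) n"
        by (simp add: eq[OF ss])
    qed (simp add: solution_map_def)
  next
    fix n i ss assume ss: "ss \<in> simplices ?X (Suc n)" and i: "i \<le> Suc n"
    note X' = X[OF ss]
    have "map ?m (nerve_face ?V (Suc n) i ss) = nerve_face G (Suc n) i (map ?m ss)"
      using X' i monomial_mult[OF _ _ supp_sub supp_sub X'(3)]
      by (intro map_nerve_face) auto
    then show "solution_map d r c A G T n (face ?X (Suc n) i ss)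
        = face (comm_nerve d G) (Suc n) i (solution_map d r c A G T (Suc n) ss)"
      unfolding eq[OF ss] eq[OF face_in_simplices[OF sX ss i]] by (simp add: ops)
  next
    fix n i ss assume ss: "ss \<in> simplices ?X n" and i: "i \<le> n"
    show "solution_map d r c A G T (Suc n) (degen ?X n i ss)
        = degen (comm_nerve d G) n i (solution_map d r c A G T n ss)"
      unfolding eq[OF ss] eq[OF degen_in_simplices[OF sX ss i]]
      by (simp add: ops map_nerve_degen monomial_one)
  qed
qed

end

section \<open>Hermitian forms and projectors\<close>

lemma hinner_adjoint: "hinner (M *v u) v = hinner u (conj_transpose M *v v)"
proof -
  have "hinner (M *v u) v = (\<Sum>i\<in>UNIV. \<Sum>j\<in>UNIV. cnj (M $ i $ j) * cnj (u $ j) * v $ i)"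
    by (simp add: hinner_def matrix_vector_mult_def sum_distrib_right)
  also have "\<dots> = (\<Sum>j\<in>UNIV. \<Sum>i\<in>UNIV. cnj (M $ i $ j) * cnj (u $ j) * v $ i)"
    by (rule sum.swap)
  also have "\<dots> = hinner u (conj_transpose M *v v)"
    by (simp add: hinner_def matrix_vector_mult_def conj_transpose_def sum_distrib_left mult_ac)
  finally show ?thesis .
qed

lemma hinner_sum_right: "hinner u (\<Sum>i\<in>I. v i) = (\<Sum>i\<in>I. hinner u (v i))"
  unfolding hinner_def by (simp add: sum_distrib_left) (rule sum.swap)

lemma hinner_sum_left: "hinner (\<Sum>i\<in>I. v i) u = (\<Sum>i\<in>I. hinner (v i) u)"
  unfolding hinner_def by (simp add: sum_distrib_right) (rule sum.swap)

lemma hinner_scale: "hinner (a *s u) (b *s v) = cnj a * b * hinner u v"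
  by (simp add: hinner_def sum_distrib_left mult_ac)

lemma hinner_self_eq_0: "hinner u u = 0 \<Longrightarrow> u = 0"
proof -
  assume "hinner u u = 0"
  moreover have "hinner u u = of_real (\<Sum>i\<in>UNIV. (norm (u $ i))\<^sup>2)"
    by (simp add: hinner_def complex_norm_square mult.commute del: of_real_power)
  ultimately have "(\<Sum>i\<in>UNIV. (norm (u $ i))\<^sup>2) = 0" by (simp del: of_real_sum)
  then show "u = 0" by (simp add: sum_nonneg_eq_0_iff vec_eq_iff)
qed

lemma hinner_axis: "hinner (axis i 1) v = v $ i"
  by (simp add: hinner_def axis_def if_distrib[of cnj] if_distrib[of "\<lambda>x. x * _"] cong: if_cong)

lemma trace_eq_hinner: "trace M = (\<Sum>i\<in>UNIV. hinner (axis i 1) (M *v axis i 1))"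
proof -
  have "(M *v axis i 1) $ i = M $ i $ i" for i
    by (simp add: matrix_vector_mult_def axis_def if_distrib[of "\<lambda>x. _ * x"] cong: if_cong)
  then show ?thesis by (simp only: hinner_axis trace_def)
qed

lemma trace_mult_sum: "trace ((M :: complex ^ 'n ^ 'n) ** (\<Sum>i\<in>I. f i)) = (\<Sum>i\<in>I. trace (M ** f i))"
proof (cases "finite I")
  case True
  then show ?thesis
    by (induction I) (simp_all add: matrix_add_ldistrib trace_add trace_0[unfolded mat_0])
qed (simp add: trace_0[unfolded mat_0])

lemma matrix_sum_vector_mult: "(\<Sum>i\<in>I. f i) *v (v :: 'a::comm_ring_1 ^ 'n) = (\<Sum>i\<in>I. f i *v v)"
  by (induction I rule: infinite_finite_induct) (simp_all add: matrix_vector_mult_add_rdistrib)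

text \<open>Cyclicity turns the trace of \<open>rho P = rho P P\<close> into that of \<open>P rho P\<close>, whose diagonal entries are
  values of the quadratic form of \<open>rho\<close>.\<close>

lemma density_trace_projector_nonneg:
  assumes "density_operator rho" "P ** P = P" "conj_transpose P = P"
  shows "0 \<le> Re (trace (rho ** P))"
proof -
  have "trace (rho ** P) = trace ((rho ** P) ** P)"
    using assms(2) by (simp flip: matrix_mul_assoc)
  also have "\<dots> = trace (P ** (rho ** P))" by (rule trace_mul_sym)
  also have "\<dots> = (\<Sum>i\<in>UNIV. hinner (P *v axis i 1) (rho *v (P *v axis i 1)))"
    using assms(3) by (simp add: trace_eq_hinner hinner_adjoint flip: matrix_vector_mul_assoc)
  finally show ?thesis using assms(1)
    by (auto simp: density_operator_def complex_nonneg_Reals_iff intro!: sum_nonneg)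
qed

text \<open>Uniqueness of the orthogonal projector: of two idempotents with the same range each absorbs the
  other from the left, and taking adjoints exchanges the two factors.\<close>

lemma orth_projector_eqI:
  assumes P: "P ** P = P" "conj_transpose P = P" "range (\<lambda>v. P *v v) = S"
  shows "orth_projector S = P"
  unfolding orth_projector_def
proof (rule the_equality)
  fix Q assume Q: "Q ** Q = Q \<and> conj_transpose Q = Q \<and> range (\<lambda>v. Q *v v) = S"
  have absorb: "M ** N = N" if M: "M ** M = M" and N: "range (\<lambda>v. N *v v) \<subseteq> range (\<lambda>v. M *v v)"
    for M N :: "complex ^ 'a ^ 'a"
  proof -
    have "M *v (N *v v) = N *v v" for v
    proof -
      obtain w where "N *v v = M *v w" using N by blast
      then show ?thesis using M by (simp add: matrix_vector_mul_assoc)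
    qed
    then show ?thesis by (simp add: matrix_eq flip: matrix_vector_mul_assoc)
  qed
  have "P = Q ** P" using absorb[of Q P] P Q by simp
  also have "\<dots> = conj_transpose (P ** Q)" using P Q by (simp add: conj_transpose_mult)
  also have "P ** Q = Q" using absorb[of P Q] P Q by simp
  finally show "Q = P" using Q by simp
qed (use assms in blast)

section \<open>Orthogonal decompositions\<close>

text \<open>Mutually orthogonal subspaces that together span the space.  Spanning is stated by the mere
  existence of components; orthogonality makes them unique, and uniqueness makes them linear in the
  vector, so that the components of vectors are the values of the orthogonal projectors.\<close>

locale orthogonal_decomposition =
  fixes I :: "'i set" and E :: "'i \<Rightarrow> (complex ^ 'n) set"
  assumes finite_index: "finite I"
    and subspace: "i \<in> I \<Longrightarrow> vec.subspace (E i)"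
    and orthogonal: "i \<in> I \<Longrightarrow> j \<in> I \<Longrightarrow> i \<noteq> j \<Longrightarrow> u \<in> E i \<Longrightarrow> v \<in> E j \<Longrightarrow> hinner u v = 0"
    and decompose: "\<exists>w. (\<forall>i\<in>I. w i \<in> E i) \<and> (\<Sum>i\<in>I. w i) = v"
begin

definition part :: "complex ^ 'n \<Rightarrow> 'i \<Rightarrow> complex ^ 'n" where
  "part v = (SOME w. (\<forall>i\<in>I. w i \<in> E i) \<and> (\<Sum>i\<in>I. w i) = v)"

lemma part_in: "i \<in> I \<Longrightarrow> part v i \<in> E i" and sum_part: "(\<Sum>i\<in>I. part v i) = v"
  using someI_ex[OF decompose[of v]] by (auto simp: part_def)

text \<open>The difference of two decompositions is a decomposition of \<open>0\<close>; pairing it with one of its own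
  components leaves just the squared norm of that component.\<close>

lemma part_unique:
  assumes "\<And>i. i \<in> I \<Longrightarrow> w i \<in> E i" "(\<Sum>i\<in>I. w i) = v" "i \<in> I"
  shows "part v i = w i"
proof -
  let ?z = "\<lambda>j. part v j - w j"
  have z: "?z j \<in> E j" if "j \<in> I" for j
    using that assms(1) part_in subspace by (simp add: vec.subspace_diff)
  have "0 = hinner (?z i) (\<Sum>j\<in>I. ?z j)"
    by (simp add: sum_subtractf sum_part assms(2) hinner_def)
  also have "\<dots> = (\<Sum>j\<in>I. if j = i then hinner (?z i) (?z i) else 0)"
    unfolding hinner_sum_right using orthogonal[OF assms(3) _ _ z[OF assms(3)] z]
    by (intro sum.cong) auto
  also have "\<dots> = hinner (?z i) (?z i)" using assms(3) finite_index by simp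
  finally show ?thesis using hinner_self_eq_0[of "?z i"] by simp
qed

lemma part_linear:
  assumes "i \<in> I"
  shows "Vector_Spaces.linear (*s) (*s) (\<lambda>v. part v i)"
proof -
  have "part (u + v) i = part u i + part v i" for u v
    using assms by (intro part_unique)
      (auto simp: sum.distrib sum_part intro: vec.subspace_add[OF subspace] part_in)
  moreover have "part (a *s v) i = a *s part v i" for a v
    using assms by (intro part_unique)
      (auto simp: sum_part simp flip: vec.scale_sum_right intro: vec.subspace_scale[OF subspace] part_in)
  ultimately show ?thesis by unfold_locales auto
qed

lemma part_part:
  assumes "i \<in> I" "j \<in> I" "u \<in> E j"
  shows "part u i = (if i = j then u else 0)"
  using assms finite_index
  by (intro part_unique) (auto intro: vec.subspace_0[OF subspace])

lemma orth_projector_eq: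
  assumes i: "i \<in> I"
  shows "orth_projector (E i) = matrix (\<lambda>v. part v i)"
    and "matrix (\<lambda>v. part v i) ** matrix (\<lambda>v. part v i) = matrix (\<lambda>v. part v i)"
    and "conj_transpose (matrix (\<lambda>v. part v i)) = matrix (\<lambda>v. part v i)"
proof -
  let ?P = "matrix (\<lambda>v. part v i)"
  have P: "?P *v v = part v i" for v by (rule matrix_works[OF part_linear[OF i]])
  show idem: "?P ** ?P = ?P"
    by (simp add: matrix_eq P part_part[OF i i part_in[OF i]] flip: matrix_vector_mul_assoc)
  have sym: "hinner (part u i) v = hinner u (part v i)" for u v
  proof -
    \<comment> \<open>Both sides equal the inner product of the two \<open>i\<close>-th components.\<close>
    have "hinner (part u i) v = (\<Sum>j\<in>I. hinner (part u i) (part v j))"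
      by (simp add: sum_part flip: hinner_sum_right)
    also have "\<dots> = (\<Sum>j\<in>I. hinner (part u j) (part v i))"
      using orthogonal[OF i _ _ part_in[OF i] part_in] orthogonal[OF _ i _ part_in part_in[OF i]]
      by (intro sum.cong refl) metis
    also have "\<dots> = hinner u (part v i)" by (simp add: sum_part flip: hinner_sum_left)
    finally show ?thesis .
  qed
  have "hinner u (conj_transpose ?P *v v) = hinner u (?P *v v)" for u v
    by (simp add: P sym flip: hinner_adjoint)
  then have "conj_transpose ?P *v v = ?P *v v" for v
    by (metis hinner_axis vec_eq_iff)
  then show herm: "conj_transpose ?P = ?P" by (simp add: matrix_eq)
  have "u \<in> range (\<lambda>v. part v i)" if "u \<in> E i" for u
    using part_part[OF i i that] by (metis rangeI)
  then have "range (\<lambda>v. ?P *v v) = E i" using part_in[OF i] by (auto simp: P)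
  with idem herm show "orth_projector (E i) = ?P" by (rule orth_projector_eqI)
qed

lemma orth_projector_vector: "i \<in> I \<Longrightarrow> orth_projector (E i) *v v = part v i"
  by (simp add: orth_projector_eq(1) matrix_works part_linear)

lemma sum_orth_projector: "(\<Sum>i\<in>I. orth_projector (E i)) = mat 1"
  by (simp add: matrix_eq matrix_sum_vector_mult orth_projector_vector sum_part)

text \<open>Grouping the components of the finer decomposition by \<open>\<phi>\<close> yields components for the coarser one,
  and these are unique.\<close>

lemma orth_projector_coarsen:
  assumes "orthogonal_decomposition K F" "\<And>i. i \<in> I \<Longrightarrow> \<phi> i \<in> K" "\<And>i. i \<in> I \<Longrightarrow> E i \<subseteq> F (\<phi> i)" "k \<in> K"
  shows "orth_projector (F k) = (\<Sum>i\<in>{i\<in>I. \<phi> i = k}. orth_projector (E i))"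
proof -
  interpret F: orthogonal_decomposition K F by fact
  have "F.part v k = (\<Sum>i\<in>{i\<in>I. \<phi> i = k}. part v i)" for v
  proof (rule F.part_unique[OF _ _ assms(4)])
    show "(\<Sum>i\<in>{i\<in>I. \<phi> i = k'}. part v i) \<in> F k'" if "k' \<in> K" for k'
      using that assms(3) part_in by (intro vec.subspace_sum F.subspace) blast+
    show "(\<Sum>k\<in>K. \<Sum>i\<in>{i\<in>I. \<phi> i = k}. part v i) = v"
      using sum.group[OF finite_index F.finite_index, of \<phi> "part v"] assms(2) sum_part by auto
  qed
  then show ?thesis
    using assms(4) by (simp add: matrix_eq matrix_sum_vector_mult F.orth_projector_vector orth_projector_vector)
qed

end

section \<open>Roots of unity\<close>

lemma omega_powi: "omega d powi a = exp (2 * of_real pi * \<i> * of_int a / of_nat d)"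
  unfolding omega_def by (simp add: exp_power_int mult_ac)

lemma norm_omega: "cmod (omega d) = 1"
  by (simp add: omega_def)

lemma omega_nonzero [simp]: "omega d \<noteq> 0"
  by (simp add: omega_def)

lemma omega_power_period: "0 < d \<Longrightarrow> omega d ^ d = 1"
  by (simp add: omega_def flip: exp_of_nat_mult)

lemma omega_powi_mod:
  assumes "0 < d" shows "omega d powi (a mod int d) = omega d powi a"
proof -
  have "omega d powi (int d * (a div int d) + a mod int d)
      = (omega d ^ d) powi (a div int d) * omega d powi (a mod int d)"
    by (subst power_int_add) (simp_all add: power_int_mult)
  then show ?thesis using assms by (simp add: omega_power_period)
qed

lemma omega_powi_eq_iff:
  assumes "0 \<le> a" "a < int d" "0 \<le> b" "b < int d"
  shows "omega d powi a = omega d powi b \<longleftrightarrow> a = b"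
proof -
  have "omega d powi a = omega d powi b \<longleftrightarrow> nat a mod d = nat b mod d"
    using assms complex_root_unity_eq[of d "nat a" "nat b"]
    by (simp add: omega_powi mult_ac of_nat_nat)
  then show ?thesis using assms by (simp add: nat_less_iff eq_nat_nat_iff)
qed

text \<open>Orthogonality of the characters of the cyclic group of order \<open>d\<close>.\<close>

lemma sum_omega_powi:
  assumes "k < d"
  shows "(\<Sum>a<d. omega d powi (- (int a * int k))) = (if k = 0 then of_nat d else 0)"
proof (cases "k = 0")
  case False
  let ?z = "omega d powi (- int k)"
  have "?z ^ d = (omega d powi int d) powi (- int k)"
    by (simp add: power_int_mult[symmetric] mult.commute flip: power_int_of_nat)
  then have "?z ^ d = 1" using assms by (simp add: omega_power_period)
  moreover have "?z \<noteq> 1"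
    using omega_powi_eq_iff[of "int k" d 0] assms False by (auto simp: power_int_minus)
  moreover have "omega d powi (- (int a * int k)) = ?z ^ a" for a
    by (simp add: power_int_mult[symmetric] mult.commute flip: power_int_of_nat)
  ultimately show ?thesis using False geometric_sum[of ?z d] by simp
qed simp

lemma mat_vector_mult: "mat a *v (v :: 'a::comm_ring_1 ^ 'n) = a *s v"
  by (simp add: matrix_vector_mult_def mat_def vec_eq_iff if_distrib[of "\<lambda>x. x * _"] cong: if_cong)

section \<open>Joint eigenspaces of commuting unitary operators\<close>

lemma subspace_joint_eigenspace: "vec.subspace (joint_eigenspace d Us as)"
  by (rule vec.subspaceI)
    (auto simp: joint_eigenspace_def matrix_vector_right_distrib vector_add_ldistrib
       vector_smult_assoc mult.commute vector_scalar_commute)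

lemma joint_eigenspace_Cons:
  "v \<in> joint_eigenspace d (U # Us) (a # as)
     \<longleftrightarrow> U *v v = (omega d powi a) *s v \<and> v \<in> joint_eigenspace d Us as"
  by (simp add: joint_eigenspace_def All_less_Suc2)

text \<open>Named because the simplices of the nerve of \<open>\<int>\<^sub>d\<close> also serve as the index set of the
  decomposition into joint eigenspaces.\<close>

definition outcomes :: "nat \<Rightarrow> nat \<Rightarrow> int list set" where
  "outcomes d n = simplices (nerve (integer_mod_group d)) n"

lemma outcomes_iff: "0 < d \<Longrightarrow> as \<in> outcomes d n \<longleftrightarrow> length as = n \<and> set as \<subseteq> {0..<int d}"
  by (auto simp: outcomes_def nerve_def carrier_integer_mod_group)

lemma outcomes_Suc: "0 < d \<Longrightarrow> outcomes d (Suc n) = (\<lambda>(a, as). a # as) ` ({0..<int d} \<times> outcomes d n)"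
  by (auto simp: outcomes_iff length_Suc_conv image_iff)

lemma finite_outcomes: "0 < d \<Longrightarrow> finite (outcomes d n)"
  by (induction n) (auto simp: outcomes_Suc, auto simp: outcomes_iff[of d] intro: finite_subset[of _ "{[]}"])

text \<open>The component of \<open>v\<close> in the eigenspace of \<open>U\<close> for \<open>omega d\<close> to the power \<open>a\<close>, for \<open>U\<close> of order
  dividing \<open>d\<close>: the discrete Fourier transform of the orbit of \<open>v\<close>.\<close>

definition eigen_part :: "nat \<Rightarrow> complex ^ 'n ^ 'n \<Rightarrow> int \<Rightarrow> complex ^ 'n \<Rightarrow> complex ^ 'n" where
  "eigen_part d U a v = (1 / of_nat d) *s (\<Sum>k<d. (omega d powi (- (a * int k))) *s (((*v) U ^^ k) v))"

text \<open>Applying \<open>U\<close> shifts the orbit by one step and the coefficients by one factor; the sum is unchanged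
  because both have period \<open>d\<close>.\<close>

lemma eigen_part_eigenvector:
  assumes "0 < d" "((*v) U ^^ d) v = v"
  shows "U *v eigen_part d U a v = (omega d powi a) *s eigen_part d U a v"
proof -
  define w where "w k = (omega d powi (- (a * int k))) *s (((*v) U ^^ k) v)" for k
  have w_Suc: "U *v w k = (omega d powi a) *s w (Suc k)" for k
  proof -
    have "omega d powi (- (a * int k)) = omega d powi a * omega d powi (- (a * int (Suc k)))"
      by (subst power_int_add[symmetric]) (auto simp: algebra_simps)
    then show ?thesis by (simp add: w_def vector_smult_assoc vector_scalar_commute)
  qed
  have "omega d powi (- (a * int d)) = (omega d ^ d) powi (- a)"
    by (simp add: power_int_mult[symmetric] mult.commute flip: power_int_of_nat)
  then have wd: "w d = w 0"
    using assms by (simp add: w_def omega_power_period)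
  have "(\<Sum>k<d. w (Suc k)) + w 0 = (\<Sum>k<d. w k) + w d"
    by (metis add.commute sum.lessThan_Suc sum.lessThan_Suc_shift)
  then have "(\<Sum>k<d. w (Suc k)) = (\<Sum>k<d. w k)" using wd by simp
  then show ?thesis
    by (simp add: eigen_part_def w_Suc vec.sum vector_scalar_commute vector_smult_assoc mult.commute
        flip: w_def vec.scale_sum_right)
qed

text \<open>Fourier inversion: when the sums are exchanged, the characters cancel on all of the orbit except
  for \<open>v\<close> itself.\<close>

lemma sum_eigen_part:
  assumes "0 < d"
  shows "(\<Sum>a\<in>{0..<int d}. eigen_part d U a v) = v"
proof -
  have "(\<Sum>a\<in>{0..<int d}. eigen_part d U a v) = (\<Sum>a<d. eigen_part d U (int a) v)"
    by (rule sum.reindex_bij_witness[of _ int nat]) auto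
  also have "\<dots> = (1 / of_nat d) *s (\<Sum>k<d. (\<Sum>a<d. omega d powi (- (int a * int k))) *s (((*v) U ^^ k) v))"
    unfolding eigen_part_def vec.scale_sum_right[symmetric] vec.scale_sum_left
    by (subst sum.swap) (rule refl)
  also have "\<dots> = (1 / of_nat d) *s (\<Sum>k<d. if k = 0 then of_nat d *s v else 0)"
    by (intro arg_cong[where f = "\<lambda>x. _ *s x"] sum.cong) (auto simp: sum_omega_powi)
  also have "\<dots> = v" using assms by simp
  finally show ?thesis .
qed

text \<open>The joint eigenspace is a subspace, and \<open>U\<close> maps it to itself because \<open>U\<close> commutes with all of
  \<open>Us\<close>.\<close>

lemma eigen_part_joint_eigenspace:
  assumes "v \<in> joint_eigenspace d Us as" "\<And>V. V \<in> set Us \<Longrightarrow> V ** U = U ** V"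
  shows "eigen_part d U a v \<in> joint_eigenspace d Us as"
proof -
  have step: "U *v x \<in> joint_eigenspace d Us as" if "x \<in> joint_eigenspace d Us as" for x
    unfolding joint_eigenspace_def
  proof (intro CollectI allI impI)
    fix i assume i: "i < length Us"
    then have "Us ! i *v (U *v x) = U *v (Us ! i *v x)"
      by (simp add: matrix_vector_mul_assoc assms(2))
    then show "Us ! i *v (U *v x) = (omega d powi as ! i) *s (U *v x)"
      using that i by (simp add: joint_eigenspace_def vector_scalar_commute)
  qed
  have "((*v) U ^^ k) v \<in> joint_eigenspace d Us as" for k
    by (induction k) (use assms(1) step in auto)
  then show ?thesis unfolding eigen_part_def
    by (intro vec.subspace_scale vec.subspace_sum subspace_joint_eigenspace)
qed

text \<open>Simultaneous diagonalisation, one operator at a time: each component of a decomposition for \<open>Us\<close> is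
  split further by the eigenspaces of \<open>U\<close>, without leaving its joint eigenspace.\<close>

lemma joint_eigenspaces_span:
  assumes "0 < d" "\<And>U V. U \<in> set Us \<Longrightarrow> V \<in> set Us \<Longrightarrow> U ** V = V ** U"
    and "\<And>U v. U \<in> set Us \<Longrightarrow> ((*v) U ^^ d) v = v"
  shows "\<exists>w. (\<forall>as\<in>outcomes d (length Us). w as \<in> joint_eigenspace d Us as) \<and>
             (\<Sum>as\<in>outcomes d (length Us). w as) = v"
  using assms(2,3)
proof (induction Us)
  case Nil
  have "outcomes d 0 = {[]}" using assms(1) by (auto simp: outcomes_iff)
  then show ?case by (intro exI[of _ "\<lambda>_. v"]) (auto simp: joint_eigenspace_def)
next
  case (Cons U Us)
  obtain w where w: "\<And>as. as \<in> outcomes d (length Us) \<Longrightarrow> w as \<in> joint_eigenspace d Us as"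
    "(\<Sum>as\<in>outcomes d (length Us). w as) = v"
    using Cons.IH Cons.prems by (metis list.set_intros(2))
  let ?w = "\<lambda>as. eigen_part d U (hd as) (w (tl as))"
  have "?w as \<in> joint_eigenspace d (U # Us) as" if outcome: "as \<in> outcomes d (length (U # Us))" for as
  proof -
    obtain a as' where as: "as = a # as'" "as' \<in> outcomes d (length Us)"
      using outcome assms(1) by (auto simp: outcomes_Suc)
    have "eigen_part d U a (w as') \<in> joint_eigenspace d Us as'"
      using Cons.prems by (intro eigen_part_joint_eigenspace w(1) as(2)) auto
    then show ?thesis
      by (simp add: as joint_eigenspace_Cons eigen_part_eigenvector assms(1) Cons.prems(2))
  qed
  moreover have "(\<Sum>as\<in>outcomes d (length (U # Us)). ?w as) = v"
  proof -
    have "(\<Sum>as\<in>outcomes d (length (U # Us)). ?w as)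
        = (\<Sum>(a, as)\<in>{0..<int d} \<times> outcomes d (length Us). eigen_part d U a (w as))"
      unfolding list.size(4) add_Suc_right add_0_right outcomes_Suc[OF assms(1)]
      by (subst sum.reindex) (auto simp: inj_on_def case_prod_beta)
    also have "\<dots> = (\<Sum>as\<in>outcomes d (length Us). \<Sum>a\<in>{0..<int d}. eigen_part d U a (w as))"
      by (subst sum.swap) (simp add: sum.cartesian_product)
    also have "\<dots> = v" using assms(1) w(2) by (simp add: sum_eigen_part)
    finally show ?thesis .
  qed
  ultimately show ?case by (intro exI[of _ ?w] conjI ballI)
qed

text \<open>At a position where the outcomes differ, a unitary operator multiplies the inner product by a
  scalar other than \<open>1\<close> and yet preserves it.\<close>

lemma joint_eigenspaces_orthogonal:
  assumes "0 < d" "\<And>U. U \<in> set Us \<Longrightarrow> conj_transpose U ** U = mat 1"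
    and "as \<in> outcomes d (length Us)" "bs \<in> outcomes d (length Us)" "as \<noteq> bs"
    and "u \<in> joint_eigenspace d Us as" "v \<in> joint_eigenspace d Us bs"
  shows "hinner u v = 0"
proof -
  have len: "length as = length Us" "length bs = length Us"
    using assms(1,3,4) by (auto simp: outcomes_iff)
  with assms(5) obtain i where i: "i < length Us" "as ! i \<noteq> bs ! i"
    by (metis nth_equalityI)
  let ?U = "Us ! i" and ?a = "omega d powi (as ! i)" and ?b = "omega d powi (bs ! i)"
  have "as ! i \<in> {0..<int d}" "bs ! i \<in> {0..<int d}"
    using assms(1,3,4) i(1) len by (auto simp: outcomes_iff subset_iff)
  then have "?a \<noteq> ?b" using i(2) by (simp add: omega_powi_eq_iff)
  have "cmod ?a = 1" by (simp add: norm_power_int norm_omega)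
  then have unit: "?a * cnj ?a = 1" by (metis complex_norm_square of_real_1 power_one)
  have neq: "cnj ?a * ?b \<noteq> 1"
  proof
    assume "cnj ?a * ?b = 1"
    then have "?a * (cnj ?a * ?b) = ?a" by (simp only: mult_1_right)
    then show False using \<open>?a \<noteq> ?b\<close> by (simp only: mult.assoc[symmetric] unit mult_1_left)
  qed
  have "hinner u v = hinner (?U *v u) (?U *v v)"
    using assms(2) i(1) by (simp add: hinner_adjoint matrix_vector_mul_assoc)
  also have "\<dots> = cnj ?a * ?b * hinner u v"
    using assms(6,7) i(1) by (simp add: joint_eigenspace_def hinner_scale)
  finally show ?thesis using neq by simp
qed

lemma orthogonal_decomposition_joint_eigenspaces:
  assumes "0 < d" "\<And>U. U \<in> set Us \<Longrightarrow> conj_transpose U ** U = mat 1"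
    and "\<And>U V. U \<in> set Us \<Longrightarrow> V \<in> set Us \<Longrightarrow> U ** V = V ** U"
    and "\<And>U v. U \<in> set Us \<Longrightarrow> ((*v) U ^^ d) v = v"
  shows "orthogonal_decomposition (outcomes d (length Us)) (joint_eigenspace d Us)"
proof
  show "\<exists>w. (\<forall>as\<in>outcomes d (length Us). w as \<in> joint_eigenspace d Us as) \<and>
             (\<Sum>as\<in>outcomes d (length Us). w as) = v" for v
    by (rule joint_eigenspaces_span[OF assms(1,3,4)])
qed (use joint_eigenspaces_orthogonal[OF assms(1,2)] finite_outcomes[OF assms(1)]
      subspace_joint_eigenspace in blast)+

section \<open>Measurement statistics of a representation\<close>

locale representation = group G for G (structure) +
  fixes d :: nat and chi :: "'a \<Rightarrow> complex ^ 'n ^ 'n" and rho :: "complex ^ 'n ^ 'n"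
  assumes d: "0 < d" and chi: "chi \<in> hom G unitary_group" and rho: "density_operator rho"
begin

abbreviation eigenspace :: "'a list \<Rightarrow> int list \<Rightarrow> (complex ^ 'n) set" where
  "eigenspace gs \<equiv> joint_eigenspace d (map chi gs)"

lemma chi_mult: "g \<in> carrier G \<Longrightarrow> h \<in> carrier G \<Longrightarrow> chi (g \<otimes> h) = chi g ** chi h"
  using hom_mult[OF chi] by (simp add: unitary_group_def)

lemma chi_unitary: "g \<in> carrier G \<Longrightarrow> conj_transpose (chi g) ** chi g = mat 1"
  using hom_in_carrier[OF chi] by (simp add: unitary_group_def)

lemma chi_one: "chi \<one> = mat 1"
  using hom_one[OF chi is_group group_unitary_group] by (simp add: unitary_group_def)

lemma chi_pow: "g \<in> carrier G \<Longrightarrow> chi (g [^] (k::nat)) *v v = ((*v) (chi g) ^^ k) v"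
proof (induction k arbitrary: v)
  case (Suc k)
  then show ?case
    by (simp add: chi_mult funpow_swap1 flip: matrix_vector_mul_assoc)
qed (simp add: chi_one)

lemma decomposition:
  assumes "gs \<in> simplices (comm_nerve d G) n"
  shows "orthogonal_decomposition (outcomes d n) (eigenspace gs)"
proof -
  have gs: "length gs = n" "set gs \<subseteq> carrier G"
    "\<And>g h. g \<in> set gs \<Longrightarrow> h \<in> set gs \<Longrightarrow> g \<otimes> h = h \<otimes> g" "\<And>g. g \<in> set gs \<Longrightarrow> g [^] d = \<one>"
    using assms by (auto simp: comm_nerve_def nerve_def)
  have "orthogonal_decomposition (outcomes d (length (map chi gs))) (eigenspace gs)"
  proof (rule orthogonal_decomposition_joint_eigenspaces[OF d])
    fix U assume "U \<in> set (map chi gs)"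
    then obtain g where g: "g \<in> set gs" "U = chi g" by auto
    show "conj_transpose U ** U = mat 1" using g gs(2) by (auto simp: chi_unitary)
    show "((*v) U ^^ d) v = v" for v
      using chi_pow[of g d v] g gs(2,4) by (auto simp: chi_one)
    fix V assume "V \<in> set (map chi gs)"
    then obtain h where h: "h \<in> set gs" "V = chi h" by auto
    have "chi g ** chi h = chi h ** chi g"
      using gs(2) gs(3)[OF g(1) h(1)] g(1) h(1) by (metis chi_mult subsetD)
    then show "U ** V = V ** U" using g h by simp
  qed
  then show ?thesis using gs(1) by simp
qed

lemma quantum_map_eq:
  assumes "gs \<in> simplices (comm_nerve d G) n"
  shows "quantum_map d G chi rho n gs as
           = (if as \<in> outcomes d n then Re (trace (rho ** orth_projector (eigenspace gs as))) else 0)"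
  using assms by (simp add: quantum_map_def outcomes_def)

lemma quantum_map_dist:
  assumes "gs \<in> simplices (comm_nerve d G) n"
  shows "quantum_map d G chi rho n gs \<in> dist_on (outcomes d n)"
proof -
  interpret orthogonal_decomposition "outcomes d n" "eigenspace gs"
    by (rule decomposition[OF assms])
  let ?q = "quantum_map d G chi rho n gs"
  have nonneg: "0 \<le> ?q as" for as
    using rho orth_projector_eq by (auto simp: quantum_map_eq[OF assms] intro!: density_trace_projector_nonneg)
  have sub: "{as. ?q as \<noteq> 0} \<subseteq> outcomes d n" by (auto simp: quantum_map_eq[OF assms])
  have "(\<Sum>as\<in>{as. ?q as \<noteq> 0}. ?q as) = (\<Sum>as\<in>outcomes d n. ?q as)"
    using sub finite_index by (intro sum.mono_neutral_left) auto
  also have "\<dots> = Re (trace (rho ** (\<Sum>as\<in>outcomes d n. orth_projector (eigenspace gs as))))"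
    by (simp add: quantum_map_eq[OF assms] trace_mult_sum)
  also have "\<dots> = 1" using rho by (simp add: sum_orth_projector density_operator_def)
  finally show ?thesis using nonneg sub finite_subset[OF sub finite_index] by (simp add: dist_on_def)
qed

text \<open>This reduces the compatibility of the measurement statistics with face and degeneracy maps to
  inclusions of joint eigenspaces: by \<open>orth_projector_coarsen\<close> the projector of a coarser measurement
  is then the sum of the projectors of the outcomes that \<open>\<phi>\<close> merges.\<close>

lemma quantum_map_push:
  assumes gs: "gs \<in> simplices (comm_nerve d G) n" and hs: "hs \<in> simplices (comm_nerve d G) m"
    and \<phi>: "\<And>as. as \<in> outcomes d n \<Longrightarrow> \<phi> as \<in> outcomes d m"
    and sub: "\<And>as. as \<in> outcomes d n \<Longrightarrow> eigenspace gs as \<subseteq> eigenspace hs (\<phi> as)"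
  shows "quantum_map d G chi rho m hs = push_dist \<phi> (quantum_map d G chi rho n gs)"
proof
  fix bs
  interpret orthogonal_decomposition "outcomes d n" "eigenspace gs"
    by (rule decomposition[OF gs])
  let ?q = "quantum_map d G chi rho n gs"
  have "push_dist \<phi> ?q bs = (\<Sum>as\<in>{as\<in>outcomes d n. \<phi> as = bs}. ?q as)"
    unfolding push_dist_def using finite_index
    by (intro sum.mono_neutral_left) (auto simp: quantum_map_eq[OF gs] split: if_splits)
  also have "\<dots> = Re (trace (rho ** (\<Sum>as\<in>{as\<in>outcomes d n. \<phi> as = bs}. orth_projector (eigenspace gs as))))"
    by (simp add: quantum_map_eq[OF gs] trace_mult_sum)
  also have "\<dots> = quantum_map d G chi rho m hs bs"
  proof (cases "bs \<in> outcomes d m")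
    case True
    then show ?thesis
      using orth_projector_coarsen[OF decomposition[OF hs] \<phi> sub] by (simp add: quantum_map_eq[OF hs])
  next
    case False
    then have "{as\<in>outcomes d n. \<phi> as = bs} = {}" using \<phi> by auto
    then show ?thesis
      by (simp only: sum.empty) (simp add: quantum_map_eq[OF hs] False trace_def matrix_matrix_mult_def)
  qed
  finally show "quantum_map d G chi rho m hs bs = push_dist \<phi> ?q bs" ..
qed

text \<open>An inner face multiplies two operators, hence their eigenvalues on a common eigenvector, and so
  adds the exponents; reducing the sum modulo \<open>d\<close> does not change the power of \<open>omega d\<close>.\<close>

lemma eigenspace_face:
  assumes "gs \<in> simplices (comm_nerve d G) (Suc n)" "as \<in> outcomes d (Suc n)" "i \<le> Suc n"
  shows "eigenspace gs as \<subseteq> eigenspace (nerve_face G (Suc n) i gs) (nerve_face (integer_mod_group d) (Suc n) i as)"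
proof
  fix v assume v: "v \<in> eigenspace gs as"
  have gs: "length gs = Suc n" "set gs \<subseteq> carrier G" using assms(1) by (auto simp: comm_nerve_def nerve_def)
  have as: "length as = Suc n" using assms(2) d by (simp add: outcomes_iff)
  have eig: "chi (gs ! k) *v v = (omega d powi (as ! k)) *s v" if "k \<le> n" for k
    using v that gs(1) by (auto simp: joint_eigenspace_def)
  have "chi (nerve_face G (Suc n) i gs ! k) *v v
      = (omega d powi (nerve_face (integer_mod_group d) (Suc n) i as ! k)) *s v" if k: "k < n" for k
  proof -
    have "gs ! k \<in> carrier G" "gs ! Suc k \<in> carrier G" using gs k by auto
    then show ?thesis
      unfolding nth_nerve_face[OF gs(1) assms(3) k] nth_nerve_face[OF as assms(3) k]
      using k
      by (auto simp: eig chi_mult omega_powi_mod[OF d] power_int_add vector_smult_assoc mult.commute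
            vector_scalar_commute simp flip: matrix_vector_mul_assoc)
  qed
  then show "v \<in> eigenspace (nerve_face G (Suc n) i gs) (nerve_face (integer_mod_group d) (Suc n) i as)"
    by (simp add: joint_eigenspace_def length_nerve_face gs assms(3))
qed

lemma eigenspace_degen:
  assumes "length gs = n" "length as = n" "i \<le> n"
  shows "eigenspace gs as \<subseteq> eigenspace (nerve_degen G n i gs) (nerve_degen (integer_mod_group d) n i as)"
  using assms by (auto simp: joint_eigenspace_def length_nerve_degen nth_nerve_degen chi_one)

lemma quantum_map_simplicial:
  "quantum_map d G chi rho \<in> simplicial_maps (comm_nerve d G) (dist_sset (nerve (integer_mod_group d)))"
proof -
  note sN = simplicial_set_comm_nerve[OF is_group, of d]
  have sZ: "simplicial_set (nerve (integer_mod_group d))"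
    by (simp add: simplicial_set_nerve group.is_monoid)
  have len: "length gs = n" if "gs \<in> simplices (comm_nerve d G) n" for gs n
    using that by (simp add: comm_nerve_def nerve_def)
  show ?thesis unfolding simplicial_maps_def
  proof (intro CollectI conjI allI ballI impI PiE_I)
    fix n i gs assume gs: "gs \<in> simplices (comm_nerve d G) (Suc n)" and i: "i \<le> Suc n"
    show "quantum_map d G chi rho n (face (comm_nerve d G) (Suc n) i gs)
        = face (dist_sset (nerve (integer_mod_group d))) (Suc n) i (quantum_map d G chi rho (Suc n) gs)"
      unfolding dist_sset_def sset.simps
    proof (rule quantum_map_push[OF gs face_in_simplices[OF sN gs i]])
      show "face (nerve (integer_mod_group d)) (Suc n) i as \<in> outcomes d n" if "as \<in> outcomes d (Suc n)" for as
        using face_in_simplices[OF sZ _ i] that by (simp add: outcomes_def)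
    qed (use eigenspace_face[OF gs _ i] in \<open>simp add: comm_nerve_def\<close>)
  next
    fix n i gs assume gs: "gs \<in> simplices (comm_nerve d G) n" and i: "i \<le> n"
    show "quantum_map d G chi rho (Suc n) (degen (comm_nerve d G) n i gs)
        = degen (dist_sset (nerve (integer_mod_group d))) n i (quantum_map d G chi rho n gs)"
      unfolding dist_sset_def sset.simps
    proof (rule quantum_map_push[OF gs degen_in_simplices[OF sN gs i]])
      show "degen (nerve (integer_mod_group d)) n i as \<in> outcomes d (Suc n)" if "as \<in> outcomes d n" for as
        using degen_in_simplices[OF sZ _ i] that by (simp add: outcomes_def)
      show "eigenspace gs as \<subseteq> eigenspace (degen (comm_nerve d G) n i gs) (degen (nerve (integer_mod_group d)) n i as)"
        if "as \<in> outcomes d n" for as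
        using eigenspace_degen[OF len[OF gs] _ i] that d by (simp add: comm_nerve_def outcomes_iff)
    qed
  qed (use quantum_map_dist in \<open>auto simp: dist_sset_def outcomes_def quantum_map_def\<close>)
qed

text \<open>If the joint eigenspace were zero, so would be its projector and hence the probability.\<close>

lemma possible_outcome_eigenvector:
  assumes "gs \<in> simplices (comm_nerve d G) n" "0 < quantum_map d G chi rho n gs as"
  obtains v where "v \<in> eigenspace gs as" "v \<noteq> 0"
proof -
  interpret orthogonal_decomposition "outcomes d n" "eigenspace gs"
    by (rule decomposition[OF assms(1)])
  have as: "as \<in> outcomes d n"
    using assms by (auto simp: quantum_map_eq split: if_splits)
  have "\<exists>v\<in>eigenspace gs as. v \<noteq> 0"
  proof (rule ccontr)
    assume "\<not> (\<exists>v\<in>eigenspace gs as. v \<noteq> 0)"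
    then have "orth_projector (eigenspace gs as) = 0"
      using part_in[OF as] by (simp add: matrix_eq orth_projector_vector[OF as])
    then have "quantum_map d G chi rho n gs as = 0"
      by (simp add: quantum_map_eq[OF assms(1)] trace_def matrix_matrix_mult_def)
    then show False using assms(2) by simp
  qed
  then show ?thesis using that by blast
qed

text \<open>Since \<open>chi J\<close> is the scalar \<open>omega d\<close>, the \<open>k\<close>-th power of \<open>J\<close> acts on every vector with the one
  eigenvalue \<open>omega d\<close> to the power \<open>k\<close>, and residues are told apart by these powers.\<close>

lemma central_power_outcome:
  assumes "J \<in> carrier G" "chi J = mat (omega d)" "0 \<le> k" "k < int d" "a \<in> {0..<int d}"
    and "[J [^] k] \<in> simplices (comm_nerve d G) (Suc 0)"
    and "0 < quantum_map d G chi rho (Suc 0) [J [^] k] [a]"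
  shows "a = k"
proof -
  obtain v where v: "v \<in> eigenspace [J [^] k] [a]" "v \<noteq> 0"
    using possible_outcome_eigenvector[OF assms(6,7)] .
  have "((*v) (mat (omega d)) ^^ m) v = (omega d ^ m) *s v" for m
    by (induction m)
      (simp_all add: vector_scalar_commute vector_smult_assoc mat_vector_mult mult.commute)
  then have "chi (J [^] k) *v v = (omega d powi k) *s v"
    using chi_pow[OF assms(1), of "nat k" v] assms(2,3)
    by (simp add: pow_nat power_int_def)
  moreover have "chi (J [^] k) *v v = (omega d powi a) *s v"
    using v(1) by (simp add: joint_eigenspace_def)
  ultimately have "omega d powi k = omega d powi a" using v(2) by simp
  then show ?thesis using assms(3,4,5) by (simp add: omega_powi_eq_iff)
qed

end

section \<open>Contextuality\<close>

text \<open>\<open>k\<close> times the indicator function of the vertex \<open>j\<close>.\<close>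

definition point_function :: "nat \<Rightarrow> nat \<Rightarrow> int \<Rightarrow> nat \<Rightarrow> int" where
  "point_function c j k = (\<lambda>l\<in>{..<c}. if l = j then k else 0)"

text \<open>All functions supported on the support of one row span simplices with each other, so on them the
  value of \<open>s\<close> on edges is additive.  The row is the combination of its indicator functions with
  coefficients \<open>A i j\<close>; hence its value is the left-hand side of the \<open>i\<close>-th equation at the point
  whose coordinates are the values of \<open>s\<close> on the indicator functions.\<close>

lemma simplicial_map_row:
  assumes d: "1 < d" and A: "\<And>j. j < c \<Longrightarrow> A i j \<in> carrier (integer_mod_group d)" and i: "i < r"
    and s: "s \<in> simplicial_maps (system_sset d r c A) (nerve (integer_mod_group d))"
  shows "hd (s (Suc 0) [row_function c A i])
           = (\<Sum>j<c. A i j * hd (s (Suc 0) [point_function c j 1])) mod int d"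
proof -
  let ?X = "system_sset d r c A" and ?V = "vertex_functions d c"
  let ?row = "row_support c A i"
  define \<phi> where "\<phi> u = hd (s (Suc 0) [u])" for u
  have A': "0 \<le> A i j" "A i j < int d" if "j < c" for j
    using A[OF that] d by (auto simp: carrier_integer_mod_group)
  have down: "Y \<in> support_complex r c A" if "Y \<subseteq> ?row" for Y
    using that i by (auto simp: support_complex_def)
  have ops: "face ?X = nerve_face ?V" "degen ?X = nerve_degen ?V"
    by (simp_all add: system_sset_def)
  have carV: "u \<in> carrier ?V \<longleftrightarrow> u \<in> extensional {..<c} \<and> (\<forall>j<c. 0 \<le> u j \<and> u j < int d)" for u
    using d by (auto simp: vertex_functions_def carrier_integer_mod_group PiE_iff)
  have mult: "\<phi> (u \<otimes>\<^bsub>?V\<^esub> v) = (\<phi> u + \<phi> v) mod int d"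
    if "u \<in> carrier ?V" "v \<in> carrier ?V" "supp c u \<subseteq> ?row" "supp c v \<subseteq> ?row" for u v
  proof -
    have "[u, v] \<in> simplices ?X (Suc (Suc 0))"
      using that down[of "supp c u \<union> supp c v"] by (simp add: system_sset_def nerve_def)
    from simplicial_map_edge_mult[OF s ops(1) this]
    show ?thesis by (simp add: \<phi>_def)
  qed
  have "[] \<in> simplices ?X 0" by (simp add: system_sset_def nerve_def support_complex_def)
  from simplicial_map_edge_one[OF s this ops(2)] have one: "\<phi> \<one>\<^bsub>?V\<^esub> = 0" by (simp add: \<phi>_def)
  \<comment> \<open>Coefficients are residues, so multiples are built by repeated addition; the coefficient \<open>0\<close> is
    kept apart because then \<open>j\<close> lies outside the support of the row.\<close>
  have zero: "point_function c j 0 = \<one>\<^bsub>?V\<^esub>" for j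
    by (auto simp: point_function_def vertex_functions_def)
  have point: "\<phi> (point_function c j (int k)) = (int k * \<phi> (point_function c j 1)) mod int d"
    if "j \<in> ?row" "k < d" for j k
    using that(2)
  proof (induction k)
    case (Suc k)
    have split: "point_function c j (int (Suc k)) = point_function c j (int k) \<otimes>\<^bsub>?V\<^esub> point_function c j 1"
      using Suc.prems by (auto simp: point_function_def vertex_functions_def)
    have "\<phi> (point_function c j (int (Suc k)))
        = (\<phi> (point_function c j (int k)) + \<phi> (point_function c j 1)) mod int d"
      unfolding split using that Suc.prems d
      by (intro mult) (auto simp: carV point_function_def supp_def split: if_splits)
    also have "\<dots> = (int (Suc k) * \<phi> (point_function c j 1)) mod int d"
      using Suc by (simp add: mod_simps algebra_simps)
    finally show ?case .
  qed (simp add: zero one)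
  have point': "\<phi> (point_function c j (A i j)) = (A i j * \<phi> (point_function c j 1)) mod int d"
    if "j < c" for j
  proof (cases "A i j = 0")
    case False
    then show ?thesis using point[of j "nat (A i j)"] that A'[OF that] by (simp add: row_support_def)
  qed (simp add: zero one)
  \<comment> \<open>The row truncated to its first \<open>m\<close> entries, for an induction that adds one vertex at a time.\<close>
  define t where "t m = (\<lambda>l\<in>{..<c}. if l < m then A i l else 0)" for m
  have "\<phi> (t m) = (\<Sum>j<m. A i j * \<phi> (point_function c j 1)) mod int d" if "m \<le> c" for m
    using that
  proof (induction m)
    case 0
    have "t 0 = \<one>\<^bsub>?V\<^esub>" by (auto simp: t_def vertex_functions_def)
    then show ?case by (simp add: one)
  next
    case (Suc m)
    have split: "t (Suc m) = t m \<otimes>\<^bsub>?V\<^esub> point_function c m (A i m)"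
      using A' by (auto simp: t_def point_function_def vertex_functions_def less_Suc_eq)
    have "\<phi> (t (Suc m)) = (\<phi> (t m) + \<phi> (point_function c m (A i m))) mod int d"
      unfolding split using A' Suc.prems d
      by (intro mult) (auto simp: carV t_def point_function_def supp_def row_support_def split: if_splits)
    then show ?case using Suc by (simp add: point' mod_simps)
  qed
  from this[of c] show ?thesis by (simp add: \<phi>_def t_def row_function_def cong: restrict_cong)
qed

theorem proposition2p15:
  fixes d r c :: nat
    and A :: "nat \<Rightarrow> nat \<Rightarrow> int" and b :: "nat \<Rightarrow> int"
    and G :: "('g, 'm) monoid_scheme" and J :: 'g and T :: "nat \<Rightarrow> 'g"
    and chi :: "'g \<Rightarrow> complex ^ 'n ^ 'n" and rho :: "complex ^ 'n ^ 'n"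
  assumes "1 < d"
    and "linear_system d r c A b"
    and "group G"
    and "J \<in> carrier G" and "\<forall>g\<in>carrier G. J \<otimes>\<^bsub>G\<^esub> g = g \<otimes>\<^bsub>G\<^esub> J" and "group.ord G J = d"
    and "chi \<in> hom G unitary_group"
    and "chi J = mat (omega d)"
    and "is_solution d r c A b G J T"
    and "\<not> (\<exists>x. is_solution d r c A b (integer_mod_group d) 1 x)"
    and "density_operator rho"
  shows "contextual (system_sset d r c A) (nerve (integer_mod_group d))
           (comp_map (system_sset d r c A) (quantum_map d G chi rho)
              (solution_map d r c A G T))"
proof -
  let ?X = "system_sset d r c A" and ?Z = "nerve (integer_mod_group d)"
  let ?f = "solution_map d r c A G T" and ?q = "quantum_map d G chi rho"
  interpret group G by fact
  interpret sol: system_solution G d r c A b J T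
    using assms(1,9) by unfold_locales auto
  interpret rep: representation G d chi rho
    using assms(1,7,11) by unfold_locales auto
  let ?p = "comp_map ?X ?q ?f"
  have "?p \<in> simplicial_distributions ?X ?Z"
    unfolding simplicial_distributions_def
    by (rule comp_map_simplicial[OF simplicial_set_system_sset sol.solution_map_simplicial
          rep.quantum_map_simplicial])
  moreover have "\<not> noncontextual ?X ?Z ?p"
  proof
    assume "noncontextual ?X ?Z ?p"
    then obtain s where s: "s \<in> simplicial_maps ?X ?Z"
      and possible: "\<And>n x. x \<in> simplices ?X n \<Longrightarrow> 0 < ?p n x (s n x)"
      using noncontextual_possible_map by blast
    \<comment> \<open>The candidate solution is read off from the indicator functions of the vertices.\<close>
    define x where "x j = hd (s (Suc 0) [point_function c j 1])" for j
    have A: "A i j \<in> carrier (integer_mod_group d)" if "i < r" "j < c" for i j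
      using assms(2) that by (simp add: linear_system_def)
    have b: "b i \<in> {0..<int d}" if "i < r" for i
      using assms(1,2) that by (simp add: linear_system_def carrier_integer_mod_group)
    have edge: "\<exists>a\<in>{0..<int d}. s (Suc 0) [u] = [a]" if "[u] \<in> simplices ?X (Suc 0)" for u
    proof -
      have "s (Suc 0) [u] \<in> simplices ?Z (Suc 0)" using s that by (auto simp: simplicial_maps_def)
      then show ?thesis
        using assms(1) by (auto simp: nerve_def length_Suc_conv carrier_integer_mod_group)
    qed
    have "(\<Sum>j<c. A i j * x j) mod int d = b i mod int d" if i: "i < r" for i
    proof -
      let ?u = "row_function c A i"
      have "supp c ?u = row_support c A i"
        by (auto simp: supp_def row_function_def row_support_def)
      then have u: "[?u] \<in> simplices ?X (Suc 0)"
        using A[OF i] i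
        by (auto simp: system_sset_def nerve_def vertex_functions_def support_complex_def
            row_function_def)
      from edge[OF u] obtain a where a: "a \<in> {0..<int d}" "s (Suc 0) [?u] = [a]" by blast
      have f: "?f (Suc 0) [?u] = [J [^]\<^bsub>G\<^esub> b i]"
        using u sol.monomial_row[OF i] by (simp add: solution_map_def monomial_def)
      have "?f (Suc 0) [?u] \<in> simplices (comm_nerve d G) (Suc 0)"
        using sol.solution_map_simplicial u by (auto simp: simplicial_maps_def)
      moreover have "0 < ?q (Suc 0) (?f (Suc 0) [?u]) [a]"
        using possible[OF u] u a(2) by (simp add: comp_map_def compose_def)
      ultimately have "a = b i"
        unfolding f using rep.central_power_outcome[OF assms(4,8)] b[OF i] a(1) by auto
      moreover have "a = (\<Sum>j<c. A i j * x j) mod int d"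
        using simplicial_map_row[OF assms(1) A[OF i] i s] a(2) by (simp add: x_def)
      ultimately show ?thesis using b[OF i] by simp
    qed
    moreover have "x j \<in> {0..<int d}" if j: "j < c" for j
    proof -
      have "supp c (point_function c j 1) = {j}"
        using j by (auto simp: supp_def point_function_def)
      then have "[point_function c j 1] \<in> simplices ?X (Suc 0)"
        using j assms(1)
        by (auto simp: system_sset_def nerve_def vertex_functions_def support_complex_def
            point_function_def carrier_integer_mod_group)
      from edge[OF this] show ?thesis by (auto simp: x_def)
    qed
    ultimately have "is_solution d r c A b (integer_mod_group d) 1 x"
      using is_solution_integer_mod_group[OF assms(1)] by blast
    then show False using assms(10) by blast
  qed
  ultimately show ?thesis by (simp add: contextual_def)
qed

end
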